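(* Let $d\ge1$ be an integer, $v\in L^1(\mathbb{R}^d)$, and let $\lambda,r,R>0$ be such that $r\le R\le\lambda/2$ and $Q_v(\lambda)<+\infty$. Suppose that $\|w-\mathcal{F}v\|_{L^\infty(B_r)}\le\delta$ for some function $w$ on $B_r$ and some $0<\delta<Q_v(\lambda)$. Then $$\|\mathcal{F}v-\mathcal{C}_{R,n^*}w\|_{L^\infty(B_R)}\le\frac{8R}{r}\left(\frac{Q_v(\lambda)}{\delta}\right)^{\tau(\lambda)}\delta,$$ where $$n^*=\left\lceil\frac{\ln\left(\frac{Q_v(\lambda)}{\delta}\right)}{\ln(2\lambda/r)}\right\rceil\qquad\text{and}\qquad\tau(\lambda)=\frac{\ln(2R/r)}{\ln(2\lambda/r)}.$$
   Context: Fourier transform: $\mathcal{F}v(\xi)=\frac{1}{(2\pi)^d}\int_{\mathbb{R}^d}e^{i\xi x}v(x)\,dx$. $B_\rho=\{\xi\in\mathbb{R}^d:|\xi|<\rho\}$. $Q_v(\lambda)=\frac{1}{(2\pi)^d}\int_{\mathbb{R}^d}e^{\lambda|x|}|v(x)|\,dx$. Chebyshev polynomials: $T_k$, $k\in\mathbb{N}=\{0,1,\dots\}$, is the polynomial with $T_k(t)=\cos(k\arccos t)$ for $t\in[-1,1]$, extended as a polynomial to $|t|>1$. Extrapolation operator: for $r>0$, $R\ge r$, $n\in\mathbb{N}$ and $w\in L^\infty(B_r)$, $$[\mathcal{C}_{R,n}w](\xi)=\begin{cases}w(\xi),&\xi\in B_r,\\ \sum_{k=0}^{n-1}a_k\left(\frac{\xi}{|\xi|}\right)T_k\left(\frac{|\xi|}{r}\right),&\xi\in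 B_R\setminus B_r,\\ 0,&\xi\in\mathbb{R}^d\setminus B_R,\end{cases}$$ where the sum is $0$ for $n=0$ and, for (almost every) $\theta\in S^{d-1}$, $a_0(\theta)=\frac1\pi\int_{-r}^r\frac{w(t\theta)}{\sqrt{r^2-t^2}}\,dt$ and $a_k(\theta)=\frac2\pi\int_{-r}^r\frac{w(t\theta)T_k(t/r)}{\sqrt{r^2-t^2}}\,dt$ for $k\ge1$. *)

theory Defs
  imports "HOL-Probability.Essential_Supremum" "HOL-Computational_Algebra.Polynomial"
begin

definition fourier :: "(real ^ 'n \<Rightarrow> complex) \<Rightarrow> real ^ 'n \<Rightarrow> complex" where
  "fourier v \<xi> =
     (1 / (2 * pi) ^ CARD('n)) *\<^sub>R (LINT x|lebesgue. exp (\<i> * complex_of_real (\<xi> \<bullet> x)) * v x)"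

definition Qexp :: "(real ^ 'n \<Rightarrow> complex) \<Rightarrow> real \<Rightarrow> ennreal" where
  "Qexp v l =
     ennreal (1 / (2 * pi) ^ CARD('n)) * (\<integral>\<^sup>+x. ennreal (exp (l * norm x) * cmod (v x)) \<partial>lebesgue)"

text \<open>The norm of \<open>L\<^sup>\<infinity>(S)\<close>; a function that is not measurable on \<open>S\<close> has infinite norm.\<close>

definition Linfty_norm :: "(real ^ 'n) set \<Rightarrow> (real ^ 'n \<Rightarrow> complex) \<Rightarrow> ereal" where
  "Linfty_norm S f =
     (if f \<in> borel_measurable (lebesgue_on S)
      then esssup (lebesgue_on S) (\<lambda>\<xi>. ereal (cmod (f \<xi>))) else \<infinity>)"

definition chebyshev :: "nat \<Rightarrow> real poly" where
  "chebyshev k = (THE p. \<forall>t\<in>{-1..1}. poly p t = cos (real k * arccos t))"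

lemma chebyshev_ex1: "\<exists>!p. \<forall>t\<in>{-1..1}. poly p t = cos (real k * arccos t)"
proof -
  have ex: "\<exists>p :: real poly. \<forall>t\<in>{-1..1}. poly p t = cos (real k * arccos t)" for k
  proof (induction k rule: less_induct)
    case (less k)
    consider "k = 0" | "k = 1" | m where "k = Suc (Suc m)"
      by (metis One_nat_def old.nat.exhaust)
    then show ?case
    proof cases
      case 1
      then show ?thesis by (intro exI[of _ "1"]) simp
    next
      case 2
      then show ?thesis by (intro exI[of _ "[:0, 1:]"]) simp
    next
      case 3
      obtain p q :: "real poly"
        where p: "\<forall>t\<in>{-1..1}. poly p t = cos (real m * arccos t)"
          and q: "\<forall>t\<in>{-1..1}. poly q t = cos (real (Suc m) * arccos t)"
        using less.IH[of m] less.IH[of "Suc m"] 3 by auto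
      have "poly ([:0, 2:] * q - p) t = cos (real k * arccos t)" if t: "t \<in> {-1..1}" for t
      proof -
        have a: "real k * arccos t = real (Suc m) * arccos t + arccos t"
          and b: "real m * arccos t = real (Suc m) * arccos t - arccos t"
          by (simp_all add: 3 algebra_simps)
        have "cos (arccos t) = t" using t by simp
        then show ?thesis
          using p q t unfolding a by (simp add: b cos_add cos_diff del: of_nat_Suc)
      qed
      then show ?thesis by blast
    qed
  qed
  have "p = q" if "\<forall>t\<in>{-1..1}. poly p t = cos (real k * arccos t)"
      "\<forall>t\<in>{-1..1}. poly q t = cos (real k * arccos t)" for p q :: "real poly"
  proof (rule ccontr)
    assume "p \<noteq> q"
    then have "finite {t. poly (p - q) t = 0}" by (intro poly_roots_finite) simp
    moreover have "{-1..1} \<subseteq> {t. poly (p - q) t = 0}" using that by auto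
    ultimately have "finite {-1..1::real}" by (rule rev_finite_subset)
    then show False using infinite_Icc[of "-1" "1::real"] by simp
  qed
  with ex show ?thesis by blast
qed

lemma poly_chebyshev: "t \<in> {-1..1} \<Longrightarrow> poly (chebyshev k) t = cos (real k * arccos t)"
  using theI'[OF chebyshev_ex1] unfolding chebyshev_def by blast

text \<open>The integrals over \<open>(-r, r)\<close> are Lebesgue integrals; for a measurable, essentially
  bounded \<open>w\<close> they exist for almost every direction \<open>\<theta>\<close>.\<close>

definition cheb_coeff :: "real \<Rightarrow> (real ^ 'n \<Rightarrow> complex) \<Rightarrow> nat \<Rightarrow> real ^ 'n \<Rightarrow> complex" where
  "cheb_coeff r w k \<theta> =
     (if k = 0
      then (1 / pi) *\<^sub>R (LINT t:{-r<..<r}|lebesgue.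
             w (t *\<^sub>R \<theta>) / complex_of_real (sqrt (r\<^sup>2 - t\<^sup>2)))
      else (2 / pi) *\<^sub>R (LINT t:{-r<..<r}|lebesgue.
             w (t *\<^sub>R \<theta>) * complex_of_real (poly (chebyshev k) (t / r))
               / complex_of_real (sqrt (r\<^sup>2 - t\<^sup>2))))"

definition extrapolate ::
    "real \<Rightarrow> real \<Rightarrow> nat \<Rightarrow> (real ^ 'n \<Rightarrow> complex) \<Rightarrow> real ^ 'n \<Rightarrow> complex" where
  "extrapolate r R n w \<xi> =
     (if \<xi> \<in> ball 0 r then w \<xi>
      else if \<xi> \<in> ball 0 R then
        (\<Sum>k<n. cheb_coeff r w k (\<xi> /\<^sub>R norm \<xi>)
                * complex_of_real (poly (chebyshev k) (norm \<xi> / r)))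
      else 0)"

end

theory Submission
  imports Defs
begin

text \<open>
  Write \<open>F\<close> for the Fourier transform of \<open>v\<close>, and \<open>\<lambda>\<close> for the variable \<open>l\<close>. Along each line \<open>t \<mapsto> t \<theta>\<close> with \<open>|\<theta>| = 1\<close> the
  function \<open>F\<close> is a superposition of exponentials \<open>exp (i t (\<theta> \<bullet> x))\<close>. Each exponential
  has a Chebyshev series on \<open>[-r, r]\<close>, the Jacobi-Anger expansion, whose coefficients are Bessel
  functions: the \<open>k\<close>-th one is at most \<open>2 (r |x| / 2)^k / k!\<close>, hence at most
  \<open>2 (r / 2 \<lambda>)^k exp (\<lambda> |x|)\<close>. Integration against \<open>v\<close> gives a series
  \<open>F (t \<theta>) = \<Sum>k. B\<^sub>k T\<^sub>k(t / r)\<close> with \<open>|B\<^sub>k| \<le> 2 Q (r / 2 \<lambda>)^k\<close>. Since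
  \<open>|T\<^sub>k(t / r)| \<le> (2 t / r)^k\<close> for \<open>t \<ge> r\<close>, the series converges for all
  \<open>t < \<lambda>\<close>, and on \<open>r \<le> t < R\<close> its tail from \<open>n\<close> on is at most \<open>4 Q (R / \<lambda>)^n\<close>
  (\<open>norm_cheb_coeff_fourier_le\<close>, \<open>fourier_chebyshev_sums\<close>).

  The coefficients computed from the data \<open>w\<close> instead of \<open>F\<close> are off by at most \<open>2 \<delta>\<close>,
  because the arcsine weight has mass \<open>\<pi>\<close>. So the first \<open>n\<close> terms contribute an error
  of at most \<open>2 \<delta> \<Sum>k<n. (2 R / r)^k\<close> (\<open>extrapolation_error_le\<close>). The number \<open>n\<^sup>*\<close> is
  the rounded-up solution \<open>x\<close> of \<open>(2 \<lambda> / r) powr x = Q / \<delta>\<close>, which balances the two errors: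
  each is then at most \<open>4 (Q / \<delta>)^\<tau> \<delta>\<close> (\<open>geometric_error_bound\<close>).

  All this is for data within \<open>\<delta>\<close> of \<open>F\<close> everywhere, whereas the hypothesis bounds \<open>w - F\<close> only
  almost everywhere, and a line is a null set in dimension at least two. By Tonelli's theorem a
  null set meets almost every line through the origin in a null set
  (\<open>AE_null_set_on_rays\<close>). Therefore replacing \<open>w\<close> by a Borel function that agrees with it almost
  everywhere on the ball changes the extrapolation only on a null set, which also
  yields its measurability.
\<close>

section \<open>Chebyshev polynomials outside the unit interval\<close>

lemma chebyshev_eqI:
  assumes "\<And>t. t \<in> {-1..1} \<Longrightarrow> poly p t = cos (real k * arccos t)"
  shows "chebyshev k = p"
  using chebyshev_ex1[of k] poly_chebyshev[of _ k] assms by blast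

lemma chebyshev_0 [simp]: "chebyshev 0 = 1"
  by (rule chebyshev_eqI) simp

lemma chebyshev_1 [simp]: "chebyshev (Suc 0) = [:0, 1:]"
  by (rule chebyshev_eqI) simp

lemma chebyshev_Suc_Suc:
  "chebyshev (Suc (Suc k)) = [:0, 2:] * chebyshev (Suc k) - chebyshev k"
proof (rule chebyshev_eqI)
  fix t :: real assume t: "t \<in> {-1..1}"
  have a: "real (Suc (Suc k)) * arccos t = real (Suc k) * arccos t + arccos t"
    and b: "real k * arccos t = real (Suc k) * arccos t - arccos t"
    by (simp_all add: algebra_simps)
  have "cos (arccos t) = t" using t by simp
  then show "poly ([:0, 2:] * chebyshev (Suc k) - chebyshev k) t
      = cos (real (Suc (Suc k)) * arccos t)"
    using t unfolding a
    by (simp add: poly_chebyshev b cos_add cos_diff del: of_nat_Suc)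
qed

text \<open>The substitution \<open>t = (z + 1/z) / 2\<close> diagonalizes the three-term recurrence. With \<open>z\<close> real it
  gives the growth of \<open>T\<^sub>k\<close> to the right of \<open>1\<close>; with \<open>z\<close> complex every real \<open>t\<close> has this form.\<close>

lemma chebyshev_Joukowski:
  fixes z :: "'a :: real_normed_field"
  assumes "z \<noteq> 0" and "z + inverse z = 2 * of_real t"
  shows "2 * of_real (poly (chebyshev k) t) = z ^ k + inverse z ^ k"
proof (induction k rule: induct_nat_012)
  case 0
  then show ?case by simp
next
  case 1
  then show ?case using assms by simp
next
  case (ge2 n)
  have "2 * of_real (poly (chebyshev (Suc (Suc n))) t)
      = (2 * of_real t) * (2 * of_real (poly (chebyshev (Suc n)) t))
        - 2 * (of_real (poly (chebyshev n) t) :: 'a)"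
    by (simp add: chebyshev_Suc_Suc algebra_simps)
  also have "\<dots> = (z + inverse z) * (z ^ Suc n + inverse z ^ Suc n) - (z ^ n + inverse z ^ n)"
    by (simp only: assms(2)[symmetric] ge2)
  also have "\<dots> = z ^ Suc (Suc n) + inverse z ^ Suc (Suc n)"
    using assms(1) by (simp add: field_simps)
  finally show ?case .
qed

lemma abs_chebyshev_le_1:
  assumes "t \<in> {-1..1}"
  shows "\<bar>poly (chebyshev k) t\<bar> \<le> 1"
  using poly_chebyshev[OF assms, of k] by simp

text \<open>For \<open>t > 1\<close> the larger root \<open>z = t + sqrt (t\<^sup>2 - 1)\<close> of \<open>z + 1/z = 2 t\<close> lies between \<open>1\<close> and
  \<open>2 t\<close>, and \<open>T\<^sub>k(t)\<close> is the mean of \<open>z^k\<close> and \<open>z^(-k)\<close>. One bound that covers \<open>[-1, 1]\<close> as well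
  saves a case distinction between interpolation and extrapolation later.\<close>

lemma abs_chebyshev_le_power:
  assumes "1 \<le> s" "-1 \<le> t" "t \<le> s"
  shows "\<bar>poly (chebyshev k) t\<bar> \<le> (2 * s) ^ k"
proof (cases "t \<le> 1")
  case True
  have "\<bar>poly (chebyshev k) t\<bar> \<le> 1"
    using True assms by (intro abs_chebyshev_le_1) auto
  also have "1 \<le> (2 * s) ^ k" using assms by (intro one_le_power) auto
  finally show ?thesis .
next
  case False
  define z where "z = t + sqrt (t\<^sup>2 - 1)"
  have t2: "1 \<le> t\<^sup>2" using False by (simp add: one_le_power)
  have z1: "1 \<le> z" unfolding z_def using False t2 by (smt (verit) real_sqrt_ge_zero)
  have "sqrt (t\<^sup>2 - 1) \<le> sqrt (t\<^sup>2)" by (rule real_sqrt_le_mono) simp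
  then have z2: "z \<le> 2 * s" unfolding z_def using False assms by simp
  have "z * (t - sqrt (t\<^sup>2 - 1)) = t\<^sup>2 - (sqrt (t\<^sup>2 - 1))\<^sup>2"
    by (simp add: z_def power2_eq_square algebra_simps)
  also have "\<dots> = 1" using t2 by simp
  finally have "inverse z = t - sqrt (t\<^sup>2 - 1)"
    by (rule inverse_unique)
  then have eq: "z + inverse z = 2 * of_real t" by (simp add: z_def)
  have "2 * poly (chebyshev k) t = z ^ k + inverse z ^ k"
    using chebyshev_Joukowski[of z t k] z1 eq by simp
  moreover have "inverse z ^ k \<le> 1" "0 \<le> inverse z ^ k" "1 \<le> z ^ k"
    using z1 by (auto intro!: power_le_one one_le_power inverse_le_1_iff[THEN iffD2])
  moreover have "z ^ k \<le> (2 * s) ^ k" using z1 z2 by (intro power_mono) auto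
  ultimately show ?thesis by linarith
qed

section \<open>Bessel-Clifford functions\<close>

text \<open>The Bessel function is \<open>J\<^sub>k(2 x) = x^k bessel_clifford k (x\<^sup>2)\<close>. Dividing out the power of \<open>x\<close>
  leaves an entire function of \<open>u = x\<^sup>2\<close>, the Bessel-Clifford function taken at \<open>-u\<close>.\<close>

definition bessel_clifford :: "nat \<Rightarrow> real \<Rightarrow> real" where
  "bessel_clifford k u = (\<Sum>j. (-1) ^ j / (fact j * fact (j + k)) * u ^ j)"

lemma summable_bessel_clifford:
  "summable (\<lambda>j. norm ((-1) ^ j / (fact j * fact (j + k)) * u ^ j :: real))"
proof (rule summable_comparison_test')
  show "summable (\<lambda>j. \<bar>u\<bar> ^ j / fact j)"
    using summable_exp[of "\<bar>u\<bar>"] by (simp add: divide_inverse mult.commute)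
  fix j
  have "\<bar>u\<bar> ^ j / (fact j * fact (j + k)) \<le> \<bar>u\<bar> ^ j / fact j"
    by (intro divide_left_mono) (auto simp: fact_ge_1 mult_le_cancel_left1)
  then show "norm (norm ((-1) ^ j / (fact j * fact (j + k)) * u ^ j)) \<le> \<bar>u\<bar> ^ j / fact j"
    by (simp add: abs_mult power_abs)
qed

lemma sums_bessel_clifford:
  "(\<lambda>j. (-1) ^ j / (fact j * fact (j + k)) * u ^ j) sums bessel_clifford k u"
  unfolding bessel_clifford_def
  by (rule summable_sums[OF summable_norm_cancel[OF summable_bessel_clifford]])

lemma DERIV_bessel_clifford:
  "(bessel_clifford k has_real_derivative - bessel_clifford (Suc k) u) (at u)"
proof -
  define c :: "nat \<Rightarrow> real" where "c j = (-1) ^ j / (fact j * fact (j + k))" for j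
  have "((\<lambda>u. \<Sum>j. c j * u ^ j) has_real_derivative (\<Sum>j. diffs c j * u ^ j)) (at u)"
    unfolding c_def
    by (intro termdiffs_strong_converges_everywhere
        summable_norm_cancel[OF summable_bessel_clifford])
  moreover have "diffs c j = - ((-1) ^ j / (fact j * fact (j + Suc k)))" for j
  proof -
    have "fact (Suc j) = real (Suc j) * fact j" by simp
    then show ?thesis
      unfolding diffs_def c_def add_Suc add_Suc_right
      by (simp del: fact_Suc of_nat_Suc)
  qed
  moreover have "(\<Sum>j. - ((-1) ^ j / (fact j * fact (j + Suc k)) * u ^ j)) = - bessel_clifford (Suc k) u"
    using sums_minus[OF sums_bessel_clifford[of "Suc k" u]] by (simp add: sums_iff)
  ultimately show ?thesis
    by (simp add: bessel_clifford_def[abs_def] c_def)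
qed

lemma bessel_clifford_recurrence:
  "u * bessel_clifford (Suc (Suc k)) u = real (Suc k) * bessel_clifford (Suc k) u - bessel_clifford k u"
proof -
  let ?a = "\<lambda>k j. (-1) ^ j / (fact j * fact (j + k)) * u ^ j :: real"
  have "(\<lambda>j. u * ?a (Suc (Suc k)) j) sums (u * bessel_clifford (Suc (Suc k)) u)"
    by (intro sums_mult sums_bessel_clifford)
  then have "(\<lambda>j. real (Suc k) * ?a (Suc k) (Suc j) - ?a k (Suc j))
      sums (u * bessel_clifford (Suc (Suc k)) u)"
  proof (rule sums_cong[THEN iffD1, rotated])
    fix j
    define p q :: real where "p = fact j" and "q = fact (Suc (j + k))"
    have pq: "p \<noteq> 0" "q \<noteq> 0" by (simp_all add: p_def q_def)
    have 1: "fact (Suc j) = real (Suc j) * p"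
      and 2: "fact (Suc (Suc (j + k))) = real (Suc (Suc (j + k))) * q"
      by (simp_all only: fact_Suc p_def q_def)
    have "u * ((-1) ^ j / (p * (real (Suc (Suc (j + k))) * q)) * u ^ j)
      = real (Suc k) * ((-1) ^ Suc j / (real (Suc j) * p * (real (Suc (Suc (j + k))) * q)) * u ^ Suc j)
        - (-1) ^ Suc j / (real (Suc j) * p * q) * u ^ Suc j"
      using pq by (simp add: divide_simps del: of_nat_Suc) (simp add: algebra_simps)
    then show "u * ?a (Suc (Suc k)) j = real (Suc k) * ?a (Suc k) (Suc j) - ?a k (Suc j)"
      unfolding add_Suc add_Suc_right 1 2 p_def[symmetric] q_def[symmetric] .
  qed
  moreover have "real (Suc k) * ?a (Suc k) 0 - ?a k 0 = 0"
    by (simp only: fact_Suc add_0) simp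
  ultimately have "(\<lambda>j. real (Suc k) * ?a (Suc k) j - ?a k j)
      sums (u * bessel_clifford (Suc (Suc k)) u)"
    using sums_Suc[of "\<lambda>j. real (Suc k) * ?a (Suc k) j - ?a k j"] by simp
  moreover have "(\<lambda>j. real (Suc k) * ?a (Suc k) j - ?a k j)
      sums (real (Suc k) * bessel_clifford (Suc k) u - bessel_clifford k u)"
    by (intro sums_diff sums_mult sums_bessel_clifford)
  ultimately show ?thesis by (rule sums_unique2)
qed

lemma bessel_clifford_0: "bessel_clifford k 0 = 1 / fact k"
  unfolding bessel_clifford_def powser_zero by simp

text \<open>This is the bound \<open>|J\<^sub>k(y)| \<le> (|y| / 2)^k / k!\<close>. With \<open>C\<^sub>k\<close> for \<open>bessel_clifford k\<close>, the energy
  \<open>C\<^sub>k(u)\<^sup>2 + u C\<^sub>k\<^sub>+\<^sub>1(u)\<^sup>2\<close> equals \<open>1 / k!\<^sup>2\<close> at \<open>u = 0\<close>, and by the recurrence its derivative is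
  \<open>- (2 k + 1) C\<^sub>k\<^sub>+\<^sub>1(u)\<^sup>2\<close>.\<close>

lemma abs_bessel_clifford_le:
  assumes "0 \<le> u"
  shows "\<bar>bessel_clifford k u\<bar> \<le> 1 / fact k"
proof -
  define W where "W u = (bessel_clifford k u)\<^sup>2 + u * (bessel_clifford (Suc k) u)\<^sup>2" for u
  have "W u \<le> W 0"
  proof (rule DERIV_nonpos_imp_nonincreasing[OF assms])
    fix x :: real assume x: "0 \<le> x" "x \<le> u"
    let ?c = "\<lambda>k. bessel_clifford k x"
    have "(W has_real_derivative (2 * ?c k * - ?c (Suc k)
        + ((?c (Suc k))\<^sup>2 + x * (2 * ?c (Suc k) * - ?c (Suc (Suc k)))))) (at x)"
      unfolding W_def[abs_def]
      by (auto intro!: derivative_eq_intros DERIV_bessel_clifford)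
    also have "2 * ?c k * - ?c (Suc k) + ((?c (Suc k))\<^sup>2 + x * (2 * ?c (Suc k) * - ?c (Suc (Suc k))))
      = 2 * ?c k * - ?c (Suc k) + (?c (Suc k))\<^sup>2 - 2 * ?c (Suc k) * (x * ?c (Suc (Suc k)))"
      by (simp add: algebra_simps)
    also have "\<dots> = - ((2 * real k + 1) * (?c (Suc k))\<^sup>2)"
      unfolding bessel_clifford_recurrence by (simp add: algebra_simps power2_eq_square)
    finally show "\<exists>y. (W has_real_derivative y) (at x) \<and> y \<le> 0"
      by (intro exI conjI) auto
  qed
  moreover have "0 \<le> u * (bessel_clifford (Suc k) u)\<^sup>2" using assms by simp
  ultimately have "(bessel_clifford k u)\<^sup>2 \<le> (1 / fact k)\<^sup>2"
    by (simp add: W_def bessel_clifford_0)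
  then show ?thesis
    by (metis abs_le_square_iff abs_of_nonneg divide_nonneg_nonneg fact_ge_zero zero_le_one)
qed

section \<open>Chebyshev expansion of the exponential\<close>

text \<open>This is \<open>J\<^sub>0(2 x)\<close> for \<open>k = 0\<close> and \<open>2 i^k J\<^sub>k(2 x)\<close> for \<open>k \<ge> 1\<close>, the \<open>k\<close>-th Chebyshev coefficient of
  \<open>t \<mapsto> exp (2 i x t)\<close>.\<close>

definition cheb_exp_coeff :: "nat \<Rightarrow> real \<Rightarrow> complex" where
  "cheb_exp_coeff k x = (if k = 0 then 1 else 2) * (\<i> * of_real x) ^ k * of_real (bessel_clifford k (x\<^sup>2))"

lemma norm_cheb_exp_coeff_le: "cmod (cheb_exp_coeff k x) \<le> 2 * (\<bar>x\<bar> ^ k / fact k)"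
proof -
  have "cmod (cheb_exp_coeff k x)
      = (if k = 0 then 1 else 2) * \<bar>x\<bar> ^ k * \<bar>bessel_clifford k (x\<^sup>2)\<bar>"
    by (simp add: cheb_exp_coeff_def norm_mult norm_power power_abs abs_mult)
  also have "\<dots> \<le> 2 * \<bar>x\<bar> ^ k * (1 / fact k)"
    by (intro mult_mono abs_bessel_clifford_le) auto
  finally show ?thesis by simp
qed

lemma has_sum_exp: "((\<lambda>m. c ^ m / fact m) has_sum exp c) (UNIV :: nat set)" for c :: complex
  using norm_summable_imp_has_sum[OF summable_norm_exp[of c] exp_converges[of c]]
  by (simp add: scaleR_conv_of_real divide_inverse mult.commute)

lemma has_sum_exp_mult_exp:
  fixes c d :: complex
  shows "((\<lambda>(m, j). (c ^ m / fact m) * (d ^ j / fact j)) has_sum (exp c * exp d)) (UNIV \<times> UNIV)"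
proof (rule has_sum_SigmaI)
  let ?e = "\<lambda>c m. c ^ m / fact m :: complex"
  have abs: "(\<lambda>m. cmod (?e c m)) summable_on UNIV" for c
    using summable_norm_exp[of c]
    by (intro norm_summable_imp_summable_on)
       (simp add: scaleR_conv_of_real divide_inverse mult.commute norm_mult norm_power norm_inverse)
  show "((\<lambda>j. case (m, j) of (m, j) \<Rightarrow> ?e c m * ?e d j) has_sum (?e c m * exp d)) UNIV" for m
    unfolding prod.case by (rule has_sum_cmult_right[OF has_sum_exp])
  show "((\<lambda>m. ?e c m * exp d) has_sum (exp c * exp d)) UNIV"
    by (rule has_sum_cmult_left[OF has_sum_exp])
  have "(\<lambda>p. cmod (case p of (m, j) \<Rightarrow> ?e c m * ?e d j)) summable_on (UNIV \<times> UNIV)"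
    unfolding Infinite_Sum.abs_summable_on_Sigma_iff
  proof (intro conjI ballI)
    show "(\<lambda>j. cmod (case (m, j) of (m, j) \<Rightarrow> ?e c m * ?e d j)) summable_on UNIV" for m
      unfolding prod.case norm_mult by (rule summable_on_cmult_right[OF abs])
    have "(\<Sum>\<^sub>\<infinity>j. cmod (?e c m * ?e d j)) = cmod (?e c m) * (\<Sum>\<^sub>\<infinity>j. cmod (?e d j))" for m
      by (simp only: norm_mult infsum_cmult_right[OF abs])
    then show "(\<lambda>m. norm (\<Sum>\<^sub>\<infinity>j. cmod (case (m, j) of (m, j) \<Rightarrow> ?e c m * ?e d j))) summable_on UNIV"
      using summable_on_cmult_left[OF abs[of c], of "\<Sum>\<^sub>\<infinity>j. cmod (?e d j)"]
      by (simp add: abs_mult infsum_nonneg del: norm_divide norm_power)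
  qed
  then show "(\<lambda>(m, j). ?e c m * ?e d j) summable_on (UNIV \<times> UNIV)"
    by (rule abs_summable_summable)
qed

lemma has_sum_bessel_clifford:
  "((\<lambda>j. a ^ (2 * j + k) / (fact j * fact (j + k))) has_sum
      (a ^ k * of_real (bessel_clifford k (x\<^sup>2)))) UNIV"
  if a: "a = \<i> * of_real x" for a :: complex
proof -
  have "((\<lambda>j. (-1) ^ j / (fact j * fact (j + k)) * (x\<^sup>2) ^ j) has_sum bessel_clifford k (x\<^sup>2)) UNIV"
    by (rule norm_summable_imp_has_sum[OF summable_bessel_clifford sums_bessel_clifford])
  then have "((\<lambda>j. of_real ((-1) ^ j / (fact j * fact (j + k)) * (x\<^sup>2) ^ j) :: complex)
      has_sum of_real (bessel_clifford k (x\<^sup>2))) UNIV"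
    by (rule has_sum_of_real)
  then have "((\<lambda>j. a ^ k * of_real ((-1) ^ j / (fact j * fact (j + k)) * (x\<^sup>2) ^ j))
      has_sum (a ^ k * of_real (bessel_clifford k (x\<^sup>2)))) UNIV"
    by (rule has_sum_cmult_right)
  moreover have "a ^ k * of_real ((-1) ^ j / (fact j * fact (j + k)) * (x\<^sup>2) ^ j)
      = a ^ (2 * j + k) / (fact j * fact (j + k))" for j
  proof -
    have "a\<^sup>2 = - of_real (x\<^sup>2)" by (simp add: a power_mult_distrib)
    then have "a ^ (2 * j) = (-1) ^ j * of_real ((x\<^sup>2) ^ j)"
      by (simp add: power_mult) (metis mult_minus1 power_mult_distrib)
    then show ?thesis by (simp add: power_add)
  qed
  ultimately show ?thesis by simp
qed

text \<open>The Jacobi-Anger expansion, valid for all real \<open>t\<close>. Writing \<open>2 t = z + 1/z\<close> and \<open>a = i x\<close>, the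
  exponential is \<open>exp (a z) exp (a / z)\<close>, an absolutely convergent double series in \<open>z^(m - j)\<close>.
  Summing along the diagonals \<open>m - j = k\<close> and \<open>m - j = -k\<close> produces the same Bessel-Clifford
  value in front of \<open>z^k\<close> and \<open>z^(-k)\<close>, and these two powers add up to \<open>2 T\<^sub>k(t)\<close>.\<close>

lemma exp_chebyshev_sums:
  "(\<lambda>k. cheb_exp_coeff k x * of_real (poly (chebyshev k) t)) sums exp (2 * \<i> * of_real (x * t))"
proof -
  define z :: complex where "z = of_real t + csqrt (of_real (t\<^sup>2 - 1))"
  have "z * (of_real t - csqrt (of_real (t\<^sup>2 - 1)))
      = of_real (t\<^sup>2) - (csqrt (of_real (t\<^sup>2 - 1)))\<^sup>2"
    by (simp add: z_def power2_eq_square algebra_simps)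
  also have "\<dots> = 1" by simp
  finally have mult1: "z * (of_real t - csqrt (of_real (t\<^sup>2 - 1))) = 1" .
  then have z0: "z \<noteq> 0" by auto
  have "inverse z = of_real t - csqrt (of_real (t\<^sup>2 - 1))"
    by (rule inverse_unique[OF mult1])
  then have zt: "z + inverse z = 2 * of_real t" by (simp add: z_def)
  define a :: complex where "a = \<i> * of_real x"
  define f where "f = (\<lambda>(m, j). ((a * z) ^ m / fact m) * ((a * inverse z) ^ j / fact j))"
  have f: "(f has_sum exp (2 * \<i> * of_real (x * t))) UNIV"
  proof -
    have "a * z + a * inverse z = 2 * \<i> * of_real (x * t)"
      by (simp only: distrib_left[symmetric] zt) (simp add: a_def)
    then have "exp (a * z) * exp (a * inverse z) = exp (2 * \<i> * of_real (x * t))"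
      by (metis exp_add)
    then show ?thesis
      unfolding f_def using has_sum_exp_mult_exp[of "a * z" "a * inverse z"] by simp
  qed
  define \<beta> where "\<beta> k = a ^ k * of_real (bessel_clifford k (x\<^sup>2))" for k
  \<comment> \<open>\<open>up\<close> enumerates the diagonals with \<open>m - j = k \<ge> 0\<close>, \<open>dn\<close> those with \<open>j - m = k + 1 > 0\<close>.\<close>
  define up where "up = (\<lambda>(k, j). (j + k, j) :: nat \<times> nat)"
  define dn where "dn = (\<lambda>(k, j). (j, j + Suc k) :: nat \<times> nat)"
  have inj: "inj up" "inj dn" by (auto simp: inj_def up_def dn_def)
  have un: "UNIV = range up \<union> range dn"
  proof -
    have "p \<in> range up \<union> range dn" for p
    proof (cases "snd p \<le> fst p")
      case True
      then have "p = up (fst p - snd p, snd p)" by (simp add: up_def)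
      then show ?thesis by blast
    next
      case False
      then have "p = dn (snd p - Suc (fst p), fst p)" by (simp add: dn_def prod_eq_iff)
      then show ?thesis by blast
    qed
    then show ?thesis by blast
  qed
  have disj: "range up \<inter> range dn = {}" by (auto simp: up_def dn_def)
  have sub: "f summable_on A" for A
    using f summable_on_subset_banach[of f UNIV A] by (auto simp: summable_on_def)
  have "exp (2 * \<i> * of_real (x * t)) = infsum f (range up) + infsum f (range dn)"
    using infsum_Un_disjoint[OF sub sub disj] un f by (simp add: infsumI)
  moreover have "(\<lambda>k. z ^ k * \<beta> k) sums infsum f (range up)"
  proof -
    have "((f \<circ> up) has_sum infsum f (range up)) (UNIV \<times> UNIV)"
      using has_sum_infsum[OF sub, of "range up"] has_sum_reindex[OF inj(1)] by auto
    moreover have "((\<lambda>j. (f \<circ> up) (k, j)) has_sum (z ^ k * \<beta> k)) UNIV" for k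
    proof -
      have "(f \<circ> up) (k, j) = z ^ k * (a ^ (2 * j + k) / (fact j * fact (j + k)))" for j
        using z0 by (simp add: f_def up_def field_simps power_add mult_2 mult_2_right)
      then show ?thesis
        using has_sum_cmult_right[OF has_sum_bessel_clifford[OF a_def, of k], of "z ^ k"]
        by (simp add: \<beta>_def)
    qed
    ultimately show ?thesis
      by (intro has_sum_imp_sums) (rule has_sum_SigmaD)
  qed
  moreover have "(\<lambda>k. if k = 0 then 0 else inverse z ^ k * \<beta> k) sums infsum f (range dn)"
  proof -
    have "((f \<circ> dn) has_sum infsum f (range dn)) (UNIV \<times> UNIV)"
      using has_sum_infsum[OF sub, of "range dn"] has_sum_reindex[OF inj(2)] by auto
    moreover have "((\<lambda>j. (f \<circ> dn) (k, j)) has_sum (inverse z ^ Suc k * \<beta> (Suc k))) UNIV" for k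
    proof -
      have "(f \<circ> dn) (k, j)
          = inverse z ^ Suc k * (a ^ (2 * j + Suc k) / (fact j * fact (j + Suc k)))" for j
        using z0 by (simp add: f_def dn_def field_simps power_add mult_2 mult_2_right del: fact_Suc)
      then show ?thesis
        using has_sum_cmult_right[OF has_sum_bessel_clifford[OF a_def, of "Suc k"], of "inverse z ^ Suc k"]
        by (simp add: \<beta>_def)
    qed
    ultimately have "(\<lambda>k. inverse z ^ Suc k * \<beta> (Suc k)) sums infsum f (range dn)"
      by (intro has_sum_imp_sums) (rule has_sum_SigmaD)
    then show ?thesis
      using sums_Suc[of "\<lambda>k. if k = 0 then 0 else inverse z ^ k * \<beta> k"] by simp
  qed
  ultimately have "(\<lambda>k. z ^ k * \<beta> k + (if k = 0 then 0 else inverse z ^ k * \<beta> k))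
      sums exp (2 * \<i> * of_real (x * t))"
    by (auto intro: sums_add)
  moreover have "z ^ k * \<beta> k + (if k = 0 then 0 else inverse z ^ k * \<beta> k)
      = cheb_exp_coeff k x * of_real (poly (chebyshev k) t)" for k
  proof (cases "k = 0")
    case False
    have "z ^ k * \<beta> k + inverse z ^ k * \<beta> k = (z ^ k + inverse z ^ k) * \<beta> k"
      by (simp add: algebra_simps)
    also have "\<dots> = 2 * of_real (poly (chebyshev k) t) * \<beta> k"
      by (simp only: chebyshev_Joukowski[OF z0 zt])
    finally show ?thesis using False by (simp add: cheb_exp_coeff_def \<beta>_def a_def)
  qed (simp add: \<beta>_def cheb_exp_coeff_def)
  ultimately show ?thesis by simp
qed

section \<open>Chebyshev coefficients as integrals\<close>

text \<open>The weight carries the indicator of \<open>(-r, r)\<close>, so that all integrals below extend over the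
  whole line and values outside the interval do not matter.\<close>

definition cheb_weight :: "real \<Rightarrow> real \<Rightarrow> real" where
  "cheb_weight r t = indicator {-r<..<r} t / sqrt (r\<^sup>2 - t\<^sup>2)"

lemma sqrt_diff_pos: "t \<in> {-r<..<r} \<Longrightarrow> 0 < sqrt (r\<^sup>2 - t\<^sup>2)" for r t :: real
  using mult_pos_pos[of "r - t" "r + t"] by (simp add: power2_eq_square algebra_simps)

lemma sqrt_diff_rescale:
  assumes "0 < r"
  shows "sqrt (r\<^sup>2 - t\<^sup>2) = r * sqrt (1 - (t / r)\<^sup>2)"
proof -
  have "r\<^sup>2 - t\<^sup>2 = r\<^sup>2 * (1 - (t / r)\<^sup>2)" using assms by (simp add: field_simps)
  then show ?thesis using assms by (simp add: real_sqrt_mult)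
qed

lemma cheb_weight_nonneg: "0 \<le> cheb_weight r t"
  using sqrt_diff_pos[of t r] by (cases "t \<in> {-r<..<r}") (auto simp: cheb_weight_def)

lemma cheb_weight_eq_0: "t \<notin> {-r<..<r} \<Longrightarrow> cheb_weight r t = 0"
  by (simp add: cheb_weight_def)

lemma borel_measurable_cheb_weight [measurable]: "cheb_weight r \<in> borel_measurable borel"
  unfolding cheb_weight_def[abs_def] by measurable

lemma
  assumes "0 < r"
  shows integrable_cheb_weight_lborel: "integrable lborel (cheb_weight r)"
    and integral_cheb_weight_lborel: "(LINT t|lborel. cheb_weight r t) = pi"
proof -
  have lim: "((\<lambda>t. arcsin (t / r)) \<longlongrightarrow> - (pi / 2)) (at_right (-r))"
            "((\<lambda>t. arcsin (t / r)) \<longlongrightarrow> pi / 2) (at_left r)"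
  proof -
    have "continuous_on {-r..r} (\<lambda>t. arcsin (t / r))"
      using assms by (intro continuous_on_arcsin continuous_intros) (auto simp: field_simps)
    then show "((\<lambda>t. arcsin (t / r)) \<longlongrightarrow> - (pi / 2)) (at_right (-r))"
              "((\<lambda>t. arcsin (t / r)) \<longlongrightarrow> pi / 2) (at_left r)"
      using assms continuous_on_Icc_at_rightD[of "-r" r] continuous_on_Icc_at_leftD[of "-r" r]
      by force+
  qed
  have deriv: "((\<lambda>t. arcsin (t / r)) has_real_derivative 1 / sqrt (r\<^sup>2 - t\<^sup>2)) (at t)"
    and cont: "isCont (\<lambda>t. 1 / sqrt (r\<^sup>2 - t\<^sup>2)) t"
    if "ereal (-r) < ereal t" "ereal t < ereal r" for t
  proof -
    from that have t: "- r < t" "t < r" by simp_all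
    have s: "0 < sqrt (r\<^sup>2 - t\<^sup>2)" using t by (intro sqrt_diff_pos) auto
    show "((\<lambda>t. arcsin (t / r)) has_real_derivative 1 / sqrt (r\<^sup>2 - t\<^sup>2)) (at t)"
      unfolding sqrt_diff_rescale[OF assms] using assms t
      by (auto intro!: derivative_eq_intros simp: field_simps)
    show "isCont (\<lambda>t. 1 / sqrt (r\<^sup>2 - t\<^sup>2)) t"
      using s by (intro continuous_intros) auto
  qed
  have nonneg: "AE x in lborel. ereal (-r) < ereal x \<longrightarrow> ereal x < ereal r \<longrightarrow> 0 \<le> 1 / sqrt (r\<^sup>2 - x\<^sup>2)"
    using sqrt_diff_pos[of _ r] by (auto intro!: AE_I2 less_imp_le)
  have lim': "(((\<lambda>t. arcsin (t / r)) \<circ> real_of_ereal) \<longlongrightarrow> - (pi / 2)) (at_right (ereal (-r)))"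
    "(((\<lambda>t. arcsin (t / r)) \<circ> real_of_ereal) \<longlongrightarrow> pi / 2) (at_left (ereal r))"
    unfolding ereal_tendsto_simps by (fact lim)+
  have "ereal (-r) < ereal r" using assms by simp
  note FTC = interval_integral_FTC_nonneg[OF this deriv cont nonneg lim']
  have eq: "cheb_weight r = (\<lambda>t. indicator {-r<..<r} t *\<^sub>R (1 / sqrt (r\<^sup>2 - t\<^sup>2)))"
    by (simp add: cheb_weight_def fun_eq_iff)
  show "integrable lborel (cheb_weight r)"
    using FTC(1) by (simp add: set_integrable_def eq)
  show "(LINT t|lborel. cheb_weight r t) = pi"
    using FTC(2) assms by (simp add: interval_lebesgue_integral_def set_lebesgue_integral_def eq)
qed

lemma integrable_cheb_weight: "0 < r \<Longrightarrow> integrable lebesgue (cheb_weight r)"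
  by (subst integrable_completion) (simp_all add: integrable_cheb_weight_lborel)

lemma integral_cheb_weight: "0 < r \<Longrightarrow> (LINT t|lebesgue. cheb_weight r t) = pi"
  by (subst integral_completion) (simp_all add: integral_cheb_weight_lborel)

text \<open>Integration against this kernel computes the \<open>k\<close>-th Chebyshev coefficient on \<open>[-r, r]\<close>, up to
  normalization.\<close>

definition cheb_kernel :: "real \<Rightarrow> nat \<Rightarrow> real \<Rightarrow> real" where
  "cheb_kernel r k t = cheb_weight r t * poly (chebyshev k) (t / r)"

lemma borel_measurable_poly [measurable]: "poly p \<in> borel_measurable borel" for p :: "real poly"
  by (intro borel_measurable_continuous_onI continuous_intros)

lemma borel_measurable_cheb_kernel [measurable]: "cheb_kernel r k \<in> borel_measurable borel"
  unfolding cheb_kernel_def[abs_def] by measurable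

lemma abs_cheb_kernel_le: "0 < r \<Longrightarrow> \<bar>cheb_kernel r k t\<bar> \<le> cheb_weight r t"
proof (cases "t \<in> {-r<..<r}")
  case True
  assume "0 < r"
  then have "\<bar>poly (chebyshev k) (t / r)\<bar> \<le> 1"
    using True by (intro abs_chebyshev_le_1) (auto simp: field_simps)
  then show ?thesis
    by (simp add: cheb_kernel_def abs_mult cheb_weight_nonneg mult_left_le)
qed (simp add: cheb_kernel_def cheb_weight_eq_0)

lemma
  fixes h :: "real \<Rightarrow> complex"
  assumes r: "0 < r" and h: "h \<in> borel_measurable lebesgue"
    and b: "\<And>t. t \<in> {-r<..<r} \<Longrightarrow> cmod (h t) \<le> b"
  shows integrable_cheb_kernel: "integrable lebesgue (\<lambda>t. cheb_kernel r k t *\<^sub>R h t)"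
    and norm_integral_cheb_kernel_le:
      "cmod (LINT t|lebesgue. cheb_kernel r k t *\<^sub>R h t) \<le> b * pi"
    and integral_norm_cheb_kernel_le:
      "(LINT t|lebesgue. cmod (cheb_kernel r k t *\<^sub>R h t)) \<le> b * pi"
proof -
  have le: "cmod (cheb_kernel r k t *\<^sub>R h t) \<le> b * cheb_weight r t" for t
  proof (cases "t \<in> {-r<..<r}")
    case True
    have "cmod (cheb_kernel r k t *\<^sub>R h t) \<le> cheb_weight r t * b"
      unfolding norm_scaleR
      using True b abs_cheb_kernel_le[OF r] by (intro mult_mono) (auto simp: cheb_weight_nonneg)
    then show ?thesis by (simp add: mult.commute)
  qed (simp add: cheb_kernel_def cheb_weight_eq_0)
  have m: "cheb_kernel r k \<in> borel_measurable lebesgue"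
    by (rule measurable_completion) simp
  have int: "integrable lebesgue (\<lambda>t. b * cheb_weight r t)"
    by (intro integrable_mult_right integrable_cheb_weight r)
  show 1: "integrable lebesgue (\<lambda>t. cheb_kernel r k t *\<^sub>R h t)"
    by (rule Bochner_Integration.integrable_bound[OF int])
       (use m h order_trans[OF le abs_ge_self] in \<open>auto intro!: borel_measurable_scaleR AE_I2\<close>)
  have "(LINT t|lebesgue. cmod (cheb_kernel r k t *\<^sub>R h t)) \<le> (LINT t|lebesgue. b * cheb_weight r t)"
    using 1 int le by (intro integral_mono integrable_norm)
  also have "\<dots> = b * pi" using integral_cheb_weight[OF r] by simp
  finally show "(LINT t|lebesgue. cmod (cheb_kernel r k t *\<^sub>R h t)) \<le> b * pi" .
  then show "cmod (LINT t|lebesgue. cheb_kernel r k t *\<^sub>R h t) \<le> b * pi"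
    using integral_norm_bound[of lebesgue "\<lambda>t. cheb_kernel r k t *\<^sub>R h t"] by linarith
qed

lemma integrable_cheb_kernel_lborel: "0 < r \<Longrightarrow> integrable lborel (cheb_kernel r k)"
  using integrable_cheb_weight_lborel[of r] abs_cheb_kernel_le[of r k] cheb_weight_nonneg
  by (auto intro!: Bochner_Integration.integrable_bound[where f = "cheb_weight r"])

text \<open>An antiderivative is \<open>- sin (k arccos (t / r)) / k\<close>, which vanishes at both ends of the
  interval.\<close>

lemma integral_cheb_kernel:
  assumes r: "0 < r"
  shows "(LINT t|lborel. cheb_kernel r k t) = (if k = 0 then pi else 0)"
proof (cases "k = 0")
  case True
  then show ?thesis using integral_cheb_weight_lborel[OF r] by (simp add: cheb_kernel_def)
next
  case False
  define F where "F t = - sin (real k * arccos (t / r)) / real k" for t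
  have lim: "(F \<longlongrightarrow> 0) (at_right (-r))" "(F \<longlongrightarrow> 0) (at_left r)"
  proof -
    have "continuous_on {-r..r} F"
      unfolding F_def[abs_def]
      using r False by (intro continuous_intros continuous_on_arccos) (auto simp: field_simps)
    moreover have "F (-r) = 0" "F r = 0" using r by (simp_all add: F_def)
    ultimately show "(F \<longlongrightarrow> 0) (at_right (-r))" "(F \<longlongrightarrow> 0) (at_left r)"
      using r continuous_on_Icc_at_rightD[of "-r" r F] continuous_on_Icc_at_leftD[of "-r" r F]
      by force+
  qed
  define f where "f t = poly (chebyshev k) (t / r) / sqrt (r\<^sup>2 - t\<^sup>2)" for t
  have eq: "cheb_kernel r k = (\<lambda>t. indicator {-r<..<r} t *\<^sub>R f t)"
    by (simp add: cheb_kernel_def cheb_weight_def fun_eq_iff f_def)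
  have "(LBINT t=ereal (-r)..ereal r. f t) = 0 - 0"
  proof (rule interval_integral_FTC_integrable[where F = F])
    fix t assume "ereal (-r) < ereal t" "ereal t < ereal r"
    then have t: "- r < t" "t < r" by simp_all
    have s: "0 < sqrt (r\<^sup>2 - t\<^sup>2)" using t by (intro sqrt_diff_pos) auto
    have "sqrt (r\<^sup>2 - t\<^sup>2) = r * sqrt (1 - (t / r)\<^sup>2)"
      by (rule sqrt_diff_rescale[OF r])
    moreover have "poly (chebyshev k) (t / r) = cos (real k * arccos (t / r))"
      using t r by (intro poly_chebyshev) (auto simp: field_simps)
    ultimately have "(F has_real_derivative f t) (at t)"
      unfolding F_def[abs_def] f_def using r t False
      by (auto intro!: derivative_eq_intros simp: field_simps)
    then show "(F has_vector_derivative f t) (at t)"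
      by (simp add: has_real_derivative_iff_has_vector_derivative)
    show "isCont f t"
      unfolding f_def[abs_def] using s by (intro continuous_intros) auto
  next
    show "set_integrable lborel (einterval (ereal (-r)) (ereal r)) f"
      using integrable_cheb_kernel_lborel[OF r, of k] by (simp add: set_integrable_def eq)
  qed (use r lim in \<open>auto simp: ereal_tendsto_simps\<close>)
  then show ?thesis
    using r False by (simp add: interval_lebesgue_integral_def set_lebesgue_integral_def eq)
qed

lemma chebyshev_mult:
  assumes "t \<in> {-1..1}" and "m \<le> k"
  shows "poly (chebyshev k) t * poly (chebyshev m) t
      = (poly (chebyshev (k + m)) t + poly (chebyshev (k - m)) t) / 2"
  using assms by (simp add: poly_chebyshev cos_times_cos of_nat_diff algebra_simps)

text \<open>The product formula reduces orthogonality to the mean values of the single kernels.\<close>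

lemma chebyshev_orthogonal:
  assumes r: "0 < r"
  shows "(LINT t|lborel. cheb_kernel r k t * poly (chebyshev m) (t / r))
      = (if k = m then if k = 0 then pi else pi / 2 else 0)"
proof -
  have aux: "(LINT t|lborel. cheb_kernel r k t * poly (chebyshev m) (t / r))
      = (if k = m then if k = 0 then pi else pi / 2 else 0)" if "m \<le> k" for k m
  proof -
    have eq: "cheb_kernel r k t * poly (chebyshev m) (t / r)
        = (cheb_kernel r (k + m) t + cheb_kernel r (k - m) t) / 2" for t
    proof (cases "t \<in> {-r<..<r}")
      case True
      then have "t / r \<in> {-1..1}" using r by (auto simp: field_simps)
      from chebyshev_mult[OF this \<open>m \<le> k\<close>] show ?thesis
        by (simp add: cheb_kernel_def mult.assoc distrib_left)
    qed (simp add: cheb_kernel_def cheb_weight_eq_0)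
    show ?thesis
      unfolding eq using that by (simp add: integrable_cheb_kernel_lborel integral_cheb_kernel r)
  qed
  show ?thesis
  proof (cases "m \<le> k")
    case False
    have "cheb_kernel r k t * poly (chebyshev m) (t / r)
        = cheb_kernel r m t * poly (chebyshev k) (t / r)" for t
      by (simp add: cheb_kernel_def)
    then show ?thesis using aux[of k m] False by simp
  qed (rule aux)
qed

lemma cheb_coeff_eq:
  "cheb_coeff r w k \<theta>
    = (if k = 0 then 1 / pi else 2 / pi) *\<^sub>R (LINT t|lebesgue. cheb_kernel r k t *\<^sub>R w (t *\<^sub>R \<theta>))"
  unfolding cheb_coeff_def set_lebesgue_integral_def
  by (auto simp: cheb_kernel_def cheb_weight_def scaleR_conv_of_real indicator_def mult_ac
      intro!: arg_cong2[where f = "(*)"] Bochner_Integration.integral_cong)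

text \<open>The weight is integrable, so an absolutely convergent Chebyshev series may be integrated term
  by term. Thus any such expansion of \<open>g\<close> along the line in direction \<open>\<theta>\<close> is the one with the
  coefficients \<open>cheb_coeff\<close>.\<close>

lemma cheb_coeff_eqI:
  assumes r: "0 < r" and B: "summable (\<lambda>m. cmod (B m))"
    and sums: "\<And>t. t \<in> {-r<..<r} \<Longrightarrow>
      (\<lambda>m. B m * of_real (poly (chebyshev m) (t / r))) sums g (t *\<^sub>R \<theta>)"
  shows "cheb_coeff r g k \<theta> = B k"
proof -
  define h where "h m t = B m * of_real (poly (chebyshev m) (t / r))" for m t
  have h_le: "cmod (h m t) \<le> cmod (B m)" if "t \<in> {-r<..<r}" for m t
    using that r abs_chebyshev_le_1[of "t / r" m]
    by (simp add: h_def norm_mult mult_left_le field_simps)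
  have h_meas: "h m \<in> borel_measurable lebesgue" for m
    unfolding h_def[abs_def] by (intro measurable_completion) simp
  have "(\<lambda>m. LINT t|lebesgue. cheb_kernel r k t *\<^sub>R h m t)
      sums (LINT t|lebesgue. (\<Sum>m. cheb_kernel r k t *\<^sub>R h m t))"
  proof (rule sums_integral)
    show "integrable lebesgue (\<lambda>t. cheb_kernel r k t *\<^sub>R h m t)" for m
      by (rule integrable_cheb_kernel[OF r h_meas h_le])
    show "AE t in lebesgue. summable (\<lambda>m. cmod (cheb_kernel r k t *\<^sub>R h m t))"
    proof (rule AE_I2)
      fix t
      show "summable (\<lambda>m. cmod (cheb_kernel r k t *\<^sub>R h m t))"
      proof (cases "t \<in> {-r<..<r}")
        case True
        then show ?thesis unfolding norm_scaleR
          by (intro summable_mult summable_comparison_test'[OF B]) (simp add: h_le)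
      qed (simp add: cheb_kernel_def cheb_weight_eq_0)
    qed
    show "summable (\<lambda>m. LINT t|lebesgue. cmod (cheb_kernel r k t *\<^sub>R h m t))"
      by (rule summable_comparison_test'[OF summable_mult2[OF B, of pi]])
         (use integral_norm_cheb_kernel_le[OF r h_meas h_le] in \<open>simp add: abs_of_nonneg integral_nonneg\<close>)
  qed
  moreover have "(\<Sum>m. cheb_kernel r k t *\<^sub>R h m t) = cheb_kernel r k t *\<^sub>R g (t *\<^sub>R \<theta>)" for t
  proof (cases "t \<in> {-r<..<r}")
    case True
    from sums_scaleR_right[OF sums[OF this], of "cheb_kernel r k t"] show ?thesis
      by (simp add: h_def sums_iff)
  qed (simp add: cheb_kernel_def cheb_weight_eq_0)
  moreover have "(LINT t|lebesgue. cheb_kernel r k t *\<^sub>R h m t)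
      = (if m = k then B k * of_real (if k = 0 then pi else pi / 2) else 0)" for m
  proof -
    have "(LINT t|lebesgue. cheb_kernel r k t *\<^sub>R h m t)
        = (LINT t|lborel. B m * of_real (cheb_kernel r k t * poly (chebyshev m) (t / r)))"
      unfolding h_def
      by (subst integral_completion) (simp_all add: scaleR_conv_of_real mult_ac)
    also have "\<dots> = B m * of_real (LINT t|lborel. cheb_kernel r k t * poly (chebyshev m) (t / r))"
      by (simp only: integral_mult_right_zero integral_complex_of_real)
    finally show ?thesis by (simp add: chebyshev_orthogonal[OF r])
  qed
  ultimately have "(\<lambda>m. if m = k then B k * of_real (if k = 0 then pi else pi / 2) else 0)
      sums (LINT t|lebesgue. cheb_kernel r k t *\<^sub>R g (t *\<^sub>R \<theta>))" by simp
  then have "(LINT t|lebesgue. cheb_kernel r k t *\<^sub>R g (t *\<^sub>R \<theta>))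
      = B k * of_real (if k = 0 then pi else pi / 2)"
    by (rule sums_unique2)
       (rule sums_single[of k "\<lambda>_. B k * of_real (if k = 0 then pi else pi / 2)"])
  then show ?thesis
    by (simp add: cheb_coeff_eq scaleR_conv_of_real)
qed

section \<open>The Fourier transform along a line\<close>

lemma power_div_fact_le_exp: "y ^ k / fact k \<le> exp y" if "0 \<le> y" for y :: real
proof -
  have "(\<lambda>k. y ^ k / fact k) sums exp y"
    using exp_converges[of y] by (simp add: divide_inverse mult.commute)
  from sum_le_suminf[OF sums_summable[OF this], of "{k}"] sums_unique[OF this] that
  show ?thesis by simp
qed

lemma borel_measurable_cheb_exp_coeff [measurable]: "cheb_exp_coeff k \<in> borel_measurable borel"
proof -
  have "continuous_on UNIV (bessel_clifford k)" for k
    by (intro continuous_at_imp_continuous_on ballI DERIV_isCont[OF DERIV_bessel_clifford])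
  then have [measurable]: "bessel_clifford k \<in> borel_measurable borel" for k
    by (rule borel_measurable_continuous_onI)
  show ?thesis unfolding cheb_exp_coeff_def[abs_def] by measurable
qed

lemma integrable_phase_mult:
  fixes v :: "real ^ 'n \<Rightarrow> complex"
  assumes "integrable lebesgue v"
  shows "integrable lebesgue (\<lambda>x. exp (\<i> * complex_of_real (\<xi> \<bullet> x)) * v x)"
proof (rule Bochner_Integration.integrable_bound[OF assms])
  have "(\<lambda>x. exp (\<i> * complex_of_real (\<xi> \<bullet> x))) \<in> borel_measurable lebesgue"
    by (rule measurable_completion) simp
  then show "(\<lambda>x. exp (\<i> * complex_of_real (\<xi> \<bullet> x)) * v x) \<in> borel_measurable lebesgue"
    using assms by (intro borel_measurable_times) auto
qed (simp add: norm_mult)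

lemma norm_fourier_le:
  fixes v :: "real ^ 'n \<Rightarrow> complex"
  shows "cmod (fourier v \<xi>) \<le> (LINT x|lebesgue. cmod (v x)) / (2 * pi) ^ CARD('n)"
  using integral_norm_bound[of lebesgue "\<lambda>x. exp (\<i> * complex_of_real (\<xi> \<bullet> x)) * v x"]
  by (simp add: fourier_def norm_mult divide_right_mono)

lemma continuous_fourier:
  fixes v :: "real ^ 'n \<Rightarrow> complex"
  assumes "integrable lebesgue v"
  shows "continuous_on UNIV (fourier v)"
proof (intro continuous_at_imp_continuous_on ballI)
  fix \<xi> :: "real ^ 'n"
  show "isCont (fourier v) \<xi>"
    unfolding continuous_at_sequentially o_def
  proof (intro allI impI)
    fix X assume X: "X \<longlonglongrightarrow> \<xi>"
    have "(\<lambda>n. LINT x|lebesgue. exp (\<i> * complex_of_real (X n \<bullet> x)) * v x)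
        \<longlonglongrightarrow> (LINT x|lebesgue. exp (\<i> * complex_of_real (\<xi> \<bullet> x)) * v x)"
      using assms X
      by (intro integral_dominated_convergence[where w = "\<lambda>x. cmod (v x)"]
          borel_measurable_integrable integrable_phase_mult integrable_norm AE_I2 tendsto_intros)
         (auto simp: norm_mult)
    then show "(\<lambda>n. fourier v (X n)) \<longlonglongrightarrow> fourier v \<xi>"
      unfolding fourier_def by (intro tendsto_scaleR tendsto_const)
  qed
qed

text \<open>The expansion of the single exponentials is multiplied by \<open>v\<close> and integrated term by term. The
  factorial in the Bessel bound is traded for the exponential weight: with \<open>y = \<lambda> |x|\<close>,
  \<open>(r |x| / 2)^k / k! = (r / 2 \<lambda>)^k (y^k / k!) \<le> (r / 2 \<lambda>)^k exp y\<close>. The resulting series is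
  dominated by a geometric one for \<open>-r \<le> t < \<lambda>\<close>. On \<open>[-r, r]\<close> it
  identifies the coefficients by \<open>cheb_coeff_eqI\<close>; beyond \<open>r\<close> it is the extrapolation.\<close>

lemma
  fixes v :: "real ^ 'n \<Rightarrow> complex" and r l :: real and \<theta> :: "real ^ 'n"
  assumes v: "integrable lebesgue v"
    and vl: "integrable lebesgue (\<lambda>x. exp (l * norm x) * cmod (v x))"
    and rl: "0 < r" "r < l" and \<theta>: "norm \<theta> = 1"
  defines "Q \<equiv> (LINT x|lebesgue. exp (l * norm x) * cmod (v x)) / (2 * pi) ^ CARD('n)"
  shows norm_cheb_coeff_fourier_le: "cmod (cheb_coeff r (fourier v) k \<theta>) \<le> 2 * Q * (r / (2 * l)) ^ k"
    and fourier_chebyshev_sums: "-r \<le> t \<Longrightarrow> t < l \<Longrightarrow>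
      (\<lambda>k. cheb_coeff r (fourier v) k \<theta> * of_real (poly (chebyshev k) (t / r)))
        sums fourier v (t *\<^sub>R \<theta>)"
proof -
  define b where "b k x = cheb_exp_coeff k (r * (x \<bullet> \<theta>) / 2)" for k and x :: "real ^ 'n"
  define B where "B k = (1 / (2 * pi) ^ CARD('n)) *\<^sub>R (LINT x|lebesgue. b k x * v x)" for k
  have b_le: "cmod (b k x * v x) \<le> 2 * (r / (2 * l)) ^ k * (exp (l * norm x) * cmod (v x))" for k x
  proof -
    have "\<bar>r * (x \<bullet> \<theta>) / 2\<bar> \<le> r / (2 * l) * (l * norm x)"
      using rl Cauchy_Schwarz_ineq2[of x \<theta>] \<theta> by (simp add: abs_mult)
    then have "\<bar>r * (x \<bullet> \<theta>) / 2\<bar> ^ k \<le> (r / (2 * l) * (l * norm x)) ^ k"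
      by (intro power_mono) auto
    then have "\<bar>r * (x \<bullet> \<theta>) / 2\<bar> ^ k / fact k \<le> (r / (2 * l)) ^ k * ((l * norm x) ^ k / fact k)"
      unfolding times_divide_eq_right power_mult_distrib[symmetric]
      by (rule divide_right_mono) simp
    also have "\<dots> \<le> (r / (2 * l)) ^ k * exp (l * norm x)"
      using rl by (intro mult_left_mono power_div_fact_le_exp) auto
    finally have "cmod (b k x) \<le> 2 * (r / (2 * l)) ^ k * exp (l * norm x)"
      using norm_cheb_exp_coeff_le[of k "r * (x \<bullet> \<theta>) / 2"] by (simp add: b_def)
    from mult_right_mono[OF this, of "cmod (v x)"] show ?thesis
      by (simp add: norm_mult mult_ac)
  qed
  have b_meas: "(\<lambda>x. b k x * v x) \<in> borel_measurable lebesgue" for k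
  proof -
    have "b k \<in> borel_measurable lebesgue"
      unfolding b_def[abs_def] by (intro measurable_completion) simp
    then show ?thesis using v by (intro borel_measurable_times) auto
  qed
  have b_int: "integrable lebesgue (\<lambda>x. b k x * v x)" for k
    by (rule Bochner_Integration.integrable_bound[OF integrable_mult_right[OF vl]])
       (use b_meas order_trans[OF b_le abs_ge_self] in \<open>auto intro!: AE_I2\<close>)
  have int_le: "(LINT x|lebesgue. cmod (b k x * v x))
      \<le> 2 * (r / (2 * l)) ^ k * (LINT x|lebesgue. exp (l * norm x) * cmod (v x))" for k
  proof -
    have "(LINT x|lebesgue. cmod (b k x * v x))
        \<le> (LINT x|lebesgue. 2 * (r / (2 * l)) ^ k * (exp (l * norm x) * cmod (v x)))"
      by (intro integral_mono integrable_norm b_int integrable_mult_right vl b_le)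
    then show ?thesis by simp
  qed
  have B_le: "cmod (B k) \<le> 2 * Q * (r / (2 * l)) ^ k" for k
  proof -
    have "cmod (LINT x|lebesgue. b k x * v x)
        \<le> 2 * (r / (2 * l)) ^ k * (LINT x|lebesgue. exp (l * norm x) * cmod (v x))"
      using integral_norm_bound[of lebesgue "\<lambda>x. b k x * v x"] int_le[of k] by linarith
    then have "cmod (LINT x|lebesgue. b k x * v x) / (2 * pi) ^ CARD('n)
        \<le> 2 * (r / (2 * l)) ^ k * (LINT x|lebesgue. exp (l * norm x) * cmod (v x)) / (2 * pi) ^ CARD('n)"
      by (rule divide_right_mono) simp
    then show ?thesis by (simp add: B_def Q_def mult_ac)
  qed
  have sums: "(\<lambda>k. B k * of_real (poly (chebyshev k) (t / r))) sums fourier v (t *\<^sub>R \<theta>)"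
    if t: "-r \<le> t" "t < l" for t
  proof -
    define T where "T k = complex_of_real (poly (chebyshev k) (t / r))" for k
    \<comment> \<open>the ratio of the dominating geometric series: \<open>r / (2 l)\<close> from the coefficients,
      \<open>2 max 1 (t / r)\<close> from the polynomials\<close>
    define q where "q = r / (2 * l) * (2 * max 1 (t / r))"
    have "q = max (r / l) (t / l)"
      using rl by (simp add: q_def max_def field_simps)
    moreover have "0 \<le> r / l" using rl by simp
    ultimately have q: "0 \<le> q" "q < 1" using rl t by (simp_all add: le_max_iff_disj)
    have T_le: "cmod (T k) \<le> (2 * max 1 (t / r)) ^ k" for k
      unfolding T_def using t rl
      by (simp only: norm_of_real) (intro abs_chebyshev_le_power, auto simp: field_simps max_def)
    have T_b: "(r / (2 * l)) ^ k * cmod (T k) \<le> q ^ k" for k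
      unfolding q_def power_mult_distrib[of "r / (2 * l)"]
      using rl by (intro mult_left_mono T_le) auto
    have "(\<lambda>k. LINT x|lebesgue. T k * (b k x * v x))
        sums (LINT x|lebesgue. (\<Sum>k. T k * (b k x * v x)))"
    proof (rule sums_integral)
      show "integrable lebesgue (\<lambda>x. T k * (b k x * v x))" for k
        by (intro integrable_mult_right b_int)
      show "AE x in lebesgue. summable (\<lambda>k. cmod (T k * (b k x * v x)))"
      proof (rule AE_I2)
        fix x
        have "cmod (T k * (b k x * v x)) \<le> 2 * (exp (l * norm x) * cmod (v x)) * q ^ k" for k
        proof -
          have "cmod (T k * (b k x * v x))
              \<le> cmod (T k) * (2 * (r / (2 * l)) ^ k * (exp (l * norm x) * cmod (v x)))"
            unfolding norm_mult[of "T k"] by (intro mult_left_mono b_le) auto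
          also have "\<dots> = 2 * (exp (l * norm x) * cmod (v x)) * ((r / (2 * l)) ^ k * cmod (T k))"
            by (simp only: mult_ac)
          also have "\<dots> \<le> 2 * (exp (l * norm x) * cmod (v x)) * q ^ k"
            by (intro mult_left_mono T_b) auto
          finally show ?thesis .
        qed
        then show "summable (\<lambda>k. cmod (T k * (b k x * v x)))"
          using q by (intro summable_comparison_test'[OF summable_mult[OF summable_geometric[of q]]])
            (auto simp del: norm_mult)
      qed
      let ?I = "LINT x|lebesgue. exp (l * norm x) * cmod (v x)"
      have "(LINT x|lebesgue. cmod (T k * (b k x * v x))) \<le> 2 * ?I * q ^ k" for k
      proof -
        have "(LINT x|lebesgue. cmod (T k * (b k x * v x)))
            = cmod (T k) * (LINT x|lebesgue. cmod (b k x * v x))"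
          unfolding norm_mult[of "T k"] by simp
        also have "\<dots> \<le> cmod (T k) * (2 * (r / (2 * l)) ^ k * ?I)"
          by (intro mult_left_mono int_le) auto
        also have "\<dots> = 2 * ?I * ((r / (2 * l)) ^ k * cmod (T k))"
          by (simp only: mult_ac)
        also have "\<dots> \<le> 2 * ?I * q ^ k"
          by (intro mult_left_mono T_b) (auto intro!: integral_nonneg)
        finally show ?thesis .
      qed
      then show "summable (\<lambda>k. LINT x|lebesgue. cmod (T k * (b k x * v x)))"
        using q by (intro summable_comparison_test'[OF summable_mult[OF summable_geometric[of q]]])
          (auto simp del: norm_mult simp: abs_of_nonneg integral_nonneg)
    qed
    moreover have "(\<Sum>k. T k * (b k x * v x)) = exp (\<i> * complex_of_real ((t *\<^sub>R \<theta>) \<bullet> x)) * v x" for x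
    proof -
      have "2 * \<i> * complex_of_real (r * (x \<bullet> \<theta>) / 2 * (t / r)) = \<i> * complex_of_real ((t *\<^sub>R \<theta>) \<bullet> x)"
        using rl by (simp add: inner_commute)
      then have "(\<lambda>k. b k x * T k) sums exp (\<i> * complex_of_real ((t *\<^sub>R \<theta>) \<bullet> x))"
        using exp_chebyshev_sums[of "r * (x \<bullet> \<theta>) / 2" "t / r"] by (simp only: b_def T_def)
      then have "(\<lambda>k. b k x * T k * v x) sums (exp (\<i> * complex_of_real ((t *\<^sub>R \<theta>) \<bullet> x)) * v x)"
        by (rule sums_mult2)
      then show ?thesis by (simp add: sums_iff mult_ac)
    qed
    ultimately have "(\<lambda>k. T k * (LINT x|lebesgue. b k x * v x))
        sums (LINT x|lebesgue. exp (\<i> * complex_of_real ((t *\<^sub>R \<theta>) \<bullet> x)) * v x)" by simp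
    from sums_scaleR_right[OF this, of "1 / (2 * pi) ^ CARD('n)"]
    show ?thesis by (simp add: fourier_def B_def T_def mult_ac)
  qed
  have "summable (\<lambda>k. cmod (B k))"
  proof (rule summable_comparison_test')
    show "summable (\<lambda>k. 2 * Q * (r / (2 * l)) ^ k)"
      using rl by (intro summable_mult summable_geometric) auto
  qed (use B_le in auto)
  then have B_eq: "cheb_coeff r (fourier v) k \<theta> = B k" for k
    by (rule cheb_coeff_eqI[OF rl(1)]) (use rl sums in auto)
  show "cmod (cheb_coeff r (fourier v) k \<theta>) \<le> 2 * Q * (r / (2 * l)) ^ k"
    using B_le B_eq by simp
  show "-r \<le> t \<Longrightarrow> t < l \<Longrightarrow>
      (\<lambda>k. cheb_coeff r (fourier v) k \<theta> * of_real (poly (chebyshev k) (t / r)))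
        sums fourier v (t *\<^sub>R \<theta>)"
    using sums B_eq by simp
qed

text \<open>The constant is the normalization \<open>2 / \<pi>\<close> times the mass \<open>\<pi>\<close> of the weight. The bound \<open>b\<close> serves
  only to make the integrals of \<open>f\<close> and \<open>g\<close> converge separately.\<close>

lemma norm_cheb_coeff_diff_le:
  fixes f g :: "real ^ 'n \<Rightarrow> complex"
  assumes r: "0 < r" and [measurable]: "f \<in> borel_measurable borel" "g \<in> borel_measurable borel"
    and g: "\<And>x. cmod (g x) \<le> b" and d: "\<And>x. cmod (f x - g x) \<le> \<delta>"
  shows "cmod (cheb_coeff r f k \<theta> - cheb_coeff r g k \<theta>) \<le> 2 * \<delta>"
proof -
  have fb: "cmod (f x) \<le> b + \<delta>" for x
    using g[of x] d[of x] norm_triangle_ineq[of "g x" "f x - g x"] by simp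
  have m: "(\<lambda>t. f (t *\<^sub>R \<theta>)) \<in> borel_measurable lebesgue" "(\<lambda>t. g (t *\<^sub>R \<theta>)) \<in> borel_measurable lebesgue"
    by (intro measurable_completion; measurable)+
  define c where "c = (if k = 0 then 1 / pi else 2 / pi)"
  have "cheb_coeff r f k \<theta> - cheb_coeff r g k \<theta>
      = c *\<^sub>R (LINT t|lebesgue. cheb_kernel r k t *\<^sub>R (f (t *\<^sub>R \<theta>) - g (t *\<^sub>R \<theta>)))"
    unfolding cheb_coeff_eq c_def[symmetric] scaleR_diff_right
    by (subst Bochner_Integration.integral_diff)
       (auto intro!: integrable_cheb_kernel[OF r] m fb g simp: scaleR_diff_right)
  also have "cmod \<dots> \<le> c * (\<delta> * pi)"
    unfolding norm_scaleR
    by (intro mult_mono norm_integral_cheb_kernel_le[OF r] borel_measurable_diff m d) (auto simp: c_def)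
  also have "\<dots> \<le> 2 * \<delta>"
    using d[of 0] norm_ge_zero[of "f 0 - g 0"] unfolding c_def by (auto simp del: norm_ge_zero)
  finally show ?thesis .
qed

text \<open>The error splits into the tail of the series of \<open>F\<close>, geometric with ratio \<open>R / \<lambda> \<le> 1/2\<close>, and
  the perturbation of the first \<open>n\<close> coefficients, amplified by the growth of the \<open>T\<^sub>k\<close>. Here the data
  are assumed Borel and uniformly close to \<open>F\<close>, so that the estimate holds in every direction.\<close>

lemma extrapolation_error_le:
  fixes v w :: "real ^ 'n \<Rightarrow> complex" and r R l \<delta> :: real
  assumes v: "integrable lebesgue v"
    and vl: "integrable lebesgue (\<lambda>x. exp (l * norm x) * cmod (v x))"
    and rR: "0 < r" "r \<le> R" "R \<le> l / 2"
    and w: "w \<in> borel_measurable borel" "\<And>x. cmod (w x - fourier v x) \<le> \<delta>"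
    and \<xi>: "r \<le> norm \<xi>" "norm \<xi> < R"
  defines "Q \<equiv> (LINT x|lebesgue. exp (l * norm x) * cmod (v x)) / (2 * pi) ^ CARD('n)"
  shows "cmod (fourier v \<xi> - extrapolate r R n w \<xi>)
      \<le> 2 * \<delta> * (\<Sum>k<n. (2 * R / r) ^ k) + 4 * Q * (R / l) ^ n"
proof -
  define \<theta> where "\<theta> = \<xi> /\<^sub>R norm \<xi>"
  define s where "s = norm \<xi>"
  have s: "r \<le> s" "s < R" "0 < s" "s < l" using \<xi> rR by (auto simp: s_def)
  have \<theta>: "norm \<theta> = 1" "s *\<^sub>R \<theta> = \<xi>" using s by (auto simp: \<theta>_def s_def)
  have rl: "0 < r" "r < l" using rR by auto
  have Q0: "0 \<le> Q" unfolding Q_def by (intro divide_nonneg_nonneg integral_nonneg) auto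
  define T where "T k = complex_of_real (poly (chebyshev k) (s / r))" for k
  define a where "a k = cheb_coeff r w k \<theta>" for k
  define B where "B k = cheb_coeff r (fourier v) k \<theta>" for k
  have T_le: "cmod (T k) \<le> (2 * R / r) ^ k" for k
  proof -
    have "cmod (T k) \<le> (2 * (R / r)) ^ k"
      unfolding T_def norm_of_real
      using s rl rR by (intro abs_chebyshev_le_power) (auto simp: field_simps intro: order_trans[of _ 0])
    then show ?thesis by simp
  qed
  have sums: "(\<lambda>k. B k * T k) sums fourier v \<xi>"
    using fourier_chebyshev_sums[OF v vl rl \<theta>(1), of s] s rl \<theta>(2) by (simp add: B_def T_def)
  have BT: "cmod (B k * T k) \<le> 2 * Q * (R / l) ^ k" for k
  proof -
    have "cmod (B k * T k) \<le> (2 * Q * (r / (2 * l)) ^ k) * (2 * R / r) ^ k"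
      unfolding norm_mult
      by (intro mult_mono T_le norm_cheb_coeff_fourier_le[OF v vl rl \<theta>(1), folded Q_def B_def])
         (use Q0 rl in auto)
    also have "\<dots> = 2 * Q * (r / (2 * l) * (2 * R / r)) ^ k"
      by (simp only: power_mult_distrib mult.assoc)
    also have "r / (2 * l) * (2 * R / r) = R / l" using rl by simp
    finally show ?thesis .
  qed
  have tail: "cmod (fourier v \<xi> - (\<Sum>k<n. B k * T k)) \<le> 4 * Q * (R / l) ^ n"
  proof -
    have q: "0 \<le> R / l" "R / l \<le> 1 / 2" using rR rl by (auto simp: field_simps)
    have "(\<lambda>k. B (k + n) * T (k + n)) sums (fourier v \<xi> - (\<Sum>k<n. B k * T k))"
      by (rule sums_split_initial_segment[OF sums])
    moreover have "(\<lambda>k. 2 * Q * (R / l) ^ n * (R / l) ^ k) sums (2 * Q * (R / l) ^ n * (1 / (1 - R / l)))"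
      using q by (intro sums_mult geometric_sums) (simp only: real_norm_def abs_of_nonneg)
    moreover have "cmod (B (k + n) * T (k + n)) \<le> 2 * Q * (R / l) ^ n * (R / l) ^ k" for k
      using BT[of "k + n"] by (simp add: power_add mult_ac)
    ultimately have "cmod (fourier v \<xi> - (\<Sum>k<n. B k * T k)) \<le> 2 * Q * (R / l) ^ n * (1 / (1 - R / l))"
      by (metis (no_types, lifting) norm_suminf_le sums_iff)
    also have "\<dots> \<le> 2 * Q * (R / l) ^ n * 2"
    proof -
      have "1 / (1 - x) \<le> 2" if "x \<le> 1 / 2" for x :: real
        using that by (simp add: field_simps)
      then show ?thesis
        using q Q0 by (intro mult_left_mono mult_nonneg_nonneg) auto
    qed
    finally show ?thesis by simp
  qed
  have head: "cmod ((\<Sum>k<n. B k * T k) - (\<Sum>k<n. a k * T k)) \<le> 2 * \<delta> * (\<Sum>k<n. (2 * R / r) ^ k)"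
  proof -
    have "cmod (B k * T k - a k * T k) \<le> 2 * \<delta> * (2 * R / r) ^ k" for k
    proof -
      have "cmod (B k - a k) \<le> 2 * \<delta>"
        unfolding a_def B_def norm_minus_commute[of "cheb_coeff r (fourier v) k \<theta>"]
        by (intro norm_cheb_coeff_diff_le[OF rl(1) w(1) _ norm_fourier_le w(2)]
            borel_measurable_continuous_onI continuous_fourier v)
      then have "cmod (B k - a k) * cmod (T k) \<le> 2 * \<delta> * (2 * R / r) ^ k"
        using order_trans[OF norm_ge_zero w(2)] by (intro mult_mono T_le) auto
      then show ?thesis by (simp add: norm_mult[symmetric] left_diff_distrib)
    qed
    then show ?thesis
      unfolding sum_subtractf[symmetric] sum_distrib_left by (rule sum_norm_le)
  qed
  have "extrapolate r R n w \<xi> = (\<Sum>k<n. a k * T k)"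
    using \<xi> by (simp add: extrapolate_def a_def T_def \<theta>_def s_def)
  then show ?thesis
    using norm_triangle_ineq[of "fourier v \<xi> - (\<Sum>k<n. B k * T k)" "(\<Sum>k<n. B k * T k) - (\<Sum>k<n. a k * T k)"]
      head tail by simp
qed

section \<open>Null sets and almost every direction\<close>

lemma AE_lborel_scaleR:
  fixes P :: "'a::euclidean_space \<Rightarrow> bool"
  assumes "c \<noteq> 0" "Measurable.pred borel P" "AE x in lborel. P x"
  shows "AE x in lborel. P (c *\<^sub>R x)"
  using assms
  by (subst lborel_affine[where t = 0 and c = "1 / c"])
     (simp_all add: AE_density AE_distr_iff)

text \<open>A Fubini argument without polar coordinates: for every \<open>t \<noteq> 0\<close> the set of \<open>x\<close> with \<open>t x \<in> N\<close> is
  a rescaled copy of \<open>N\<close>, hence null. Exchanging the quantifiers, for almost every \<open>x\<close> the set of \<open>t\<close>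
  with \<open>t x \<in> N\<close> is null, and rescaling \<open>t\<close> normalizes \<open>x\<close>.\<close>

lemma AE_null_set_on_rays:
  fixes N :: "'a::euclidean_space set"
  assumes N: "N \<in> null_sets lborel"
  shows "AE x in lborel. AE t in lborel. t *\<^sub>R (x /\<^sub>R norm x) \<notin> N"
proof -
  have [measurable]: "N \<in> sets borel" using N by auto
  have "AE t in lborel. AE x in lborel. t *\<^sub>R x \<notin> N"
    using AE_lborel_singleton[of "0::real"]
    by eventually_elim (rule AE_lborel_scaleR, auto intro: AE_not_in[OF N])
  then have "AE x in lborel. AE t in lborel. t *\<^sub>R x \<notin> N"
    by (subst (asm) lborel_pair.AE_commute) measurable
  with AE_lborel_singleton[of "0::'a"] show ?thesis
  proof eventually_elim
    fix x :: 'a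
    assume "x \<noteq> 0" "AE t in lborel. t *\<^sub>R x \<notin> N"
    then have "AE t in lborel. (inverse (norm x) *\<^sub>R t) *\<^sub>R x \<notin> N"
      by (intro AE_lborel_scaleR[where P = "\<lambda>t. t *\<^sub>R x \<notin> N"]) auto
    then show "AE t in lborel. t *\<^sub>R (x /\<^sub>R norm x) \<notin> N"
      by (simp add: mult.commute)
  qed
qed

lemma complex_lebesgue_borel_representative:
  fixes f :: "'a::euclidean_space \<Rightarrow> complex"
  assumes "f \<in> borel_measurable lebesgue"
  obtains g where "g \<in> borel_measurable borel" "AE x in lborel. f x = g x"
proof -
  from completion_ex_borel_measurable_real[of "\<lambda>x. Re (f x)" lborel]
  obtain a where a: "a \<in> borel_measurable lborel" "AE x in lborel. Re (f x) = a x"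
    using assms by auto
  from completion_ex_borel_measurable_real[of "\<lambda>x. Im (f x)" lborel]
  obtain b where b: "b \<in> borel_measurable lborel" "AE x in lborel. Im (f x) = b x"
    using assms by auto
  have [measurable]: "a \<in> borel_measurable borel" "b \<in> borel_measurable borel"
    using a b by simp_all
  show thesis
  proof
    show "(\<lambda>x. of_real (a x) + \<i> * of_real (b x)) \<in> borel_measurable borel" by measurable
    show "AE x in lborel. f x = of_real (a x) + \<i> * of_real (b x)"
      using a(2) b(2) by eventually_elim (simp add: complex_eq_iff)
  qed
qed

lemma borel_measurable_extrapolate:
  assumes [measurable]: "w \<in> borel_measurable borel"
  shows "extrapolate r R n w \<in> borel_measurable borel"
proof -
  have [measurable]: "(\<lambda>x. cheb_coeff r w k (x /\<^sub>R norm x)) \<in> borel_measurable borel" for k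
  proof -
    have "cheb_coeff r w k (x /\<^sub>R norm x) = (if k = 0 then 1 / pi else 2 / pi) *\<^sub>R
        (LINT t|lborel. cheb_kernel r k t *\<^sub>R w (t *\<^sub>R (x /\<^sub>R norm x)))" for x
      unfolding cheb_coeff_eq by (subst integral_completion) measurable
    then show ?thesis by simp
  qed
  show ?thesis unfolding extrapolate_def[abs_def] mem_ball by measurable
qed

text \<open>Completeness of Lebesgue measure makes \<open>w\<close> measurable along the line, being equal to the Borel
  function \<open>w'\<close> almost everywhere on the support of the kernel.\<close>

lemma cheb_coeff_cong_AE:
  assumes [measurable]: "w' \<in> borel_measurable borel"
    and "AE t in lborel. t \<in> {-r<..<r} \<longrightarrow> w (t *\<^sub>R \<theta>) = w' (t *\<^sub>R \<theta>)"
  shows "cheb_coeff r w k \<theta> = cheb_coeff r w' k \<theta>"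
proof -
  have ae: "AE t in lebesgue. cheb_kernel r k t *\<^sub>R w' (t *\<^sub>R \<theta>) = cheb_kernel r k t *\<^sub>R w (t *\<^sub>R \<theta>)"
    using AE_completion[OF assms(2)] by eventually_elim (metis cheb_kernel_def cheb_weight_eq_0 mult_zero_left scaleR_zero_left)
  have m: "(\<lambda>t. cheb_kernel r k t *\<^sub>R w' (t *\<^sub>R \<theta>)) \<in> borel_measurable lebesgue"
    by (rule measurable_completion) measurable
  have "(LINT t|lebesgue. cheb_kernel r k t *\<^sub>R w' (t *\<^sub>R \<theta>))
      = (LINT t|lebesgue. cheb_kernel r k t *\<^sub>R w (t *\<^sub>R \<theta>))"
    by (rule integral_cong_AE[OF m borel_measurable_AE[OF m ae] ae])
  then show ?thesis by (simp add: cheb_coeff_eq)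
qed

text \<open>Where \<open>w\<close> is bad, and outside the ball, the approximant is \<open>F\<close> itself. This makes it
  Borel and \<open>\<delta>\<close>-close to \<open>F\<close> without exception.\<close>

lemma borel_approximant_on_ball:
  fixes w F :: "real ^ 'n \<Rightarrow> complex"
  assumes w: "w \<in> borel_measurable (lebesgue_on (ball 0 r))"
    and F: "F \<in> borel_measurable borel"
    and le: "AE x in lebesgue. x \<in> ball 0 r \<longrightarrow> cmod (w x - F x) \<le> \<delta>" and "0 \<le> \<delta>"
  obtains w' N where "w' \<in> borel_measurable borel" "\<And>x. cmod (w' x - F x) \<le> \<delta>"
    "N \<in> null_sets lborel" "\<And>x. x \<in> ball 0 r \<Longrightarrow> x \<notin> N \<Longrightarrow> w x = w' x"
proof -
  have "(\<lambda>x. if x \<in> ball 0 r then w x else 0) \<in> borel_measurable lebesgue"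
    using w by (subst borel_measurable_if) auto
  then obtain g where [measurable]: "g \<in> borel_measurable borel"
    and g: "AE x in lborel. (if x \<in> ball 0 r then w x else 0) = g x"
    by (rule complex_lebesgue_borel_representative)
  have "AE x in lborel. x \<in> ball 0 r \<longrightarrow> w x = g x \<and> cmod (g x - F x) \<le> \<delta>"
    using g le[unfolded AE_completion_iff] by eventually_elim auto
  then obtain N where "\<And>x. x \<in> space lborel - N \<Longrightarrow>
      x \<in> ball 0 r \<longrightarrow> w x = g x \<and> cmod (g x - F x) \<le> \<delta>"
    and null: "N \<in> null_sets lborel"
    by (rule AE_E3) blast
  then have N: "\<And>x. x \<in> ball 0 r \<Longrightarrow> x \<notin> N \<Longrightarrow> w x = g x \<and> cmod (g x - F x) \<le> \<delta>"
    "N \<in> null_sets lborel"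
    by auto
  have [measurable]: "N \<in> sets borel" "F \<in> borel_measurable borel" using N F by auto
  show thesis
  proof
    have "ball 0 r - N \<in> sets borel" by simp
    then show "(\<lambda>x. if x \<in> ball 0 r - N then g x else F x) \<in> borel_measurable borel"
      by (intro measurable_If_set) simp_all
  qed (use N \<open>0 \<le> \<delta>\<close> in auto)
qed

section \<open>The extrapolation error\<close>

text \<open>With \<open>u = 2 R / r \<ge> 2\<close> and the exact solution \<open>x\<close> of \<open>(2 \<lambda> / r) powr x = Q / \<delta>\<close> one has
  \<open>(Q / \<delta>)^\<tau> = u powr x\<close> and \<open>x \<le> n < x + 1\<close>. The upper bound on \<open>n\<close> controls the geometric sum,
  which is at most \<open>u^n / (u - 1) \<le> u / (u - 1) \<cdot> u powr x \<le> 2 u powr x\<close>; the lower bound controls the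
  tail, as \<open>R / \<lambda> = u / (2 \<lambda> / r)\<close> gives \<open>Q (R / \<lambda>)^n \<le> Q (R / \<lambda>) powr x = \<delta> u powr x\<close>.\<close>

lemma geometric_error_bound:
  fixes r R l \<delta> Q :: real
  assumes "0 < r" "r \<le> R" "R \<le> l / 2" "0 < \<delta>" "\<delta> < Q"
  defines "n \<equiv> nat \<lceil>ln (Q / \<delta>) / ln (2 * l / r)\<rceil>"
    and "\<tau> \<equiv> ln (2 * R / r) / ln (2 * l / r)"
  shows "2 * \<delta> * (\<Sum>k<n. (2 * R / r) ^ k) + 4 * Q * (R / l) ^ n
      \<le> 8 * R / r * (Q / \<delta>) powr \<tau> * \<delta>" (is ?le)
    and "\<delta> \<le> 8 * R / r * (Q / \<delta>) powr \<tau> * \<delta>" (is ?le')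
proof -
  define x where "x = ln (Q / \<delta>) / ln (2 * l / r)"
  define u where "u = 2 * R / r"
  define E where "E = (Q / \<delta>) powr \<tau>"
  have u: "2 \<le> u" using assms by (simp add: u_def field_simps)
  have lr: "4 \<le> 2 * l / r" using assms by (simp add: field_simps)
  have Q1: "1 < Q / \<delta>" using assms by simp
  have lnQ: "0 < ln (Q / \<delta>)" "0 < ln (2 * l / r)" using Q1 lr by (auto intro: ln_gt_zero)
  then have x: "0 < x" by (simp add: x_def)
  have n: "x \<le> real n" "real n < x + 1"
    using x unfolding n_def x_def[symmetric] by linarith+
  have E_eq: "E = u powr x"
    using u Q1 assms lr by (simp add: E_def \<tau>_def x_def powr_def u_def)
  have Rl: "0 < R / l" "R / l \<le> 1" using assms by (auto simp: field_simps)
  have "u ^ n = u powr real n" using u by (simp add: powr_realpow)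
  also have "\<dots> \<le> u powr (x + 1)" using u n by (intro powr_mono) auto
  also have "\<dots> = u * E" using u by (simp add: powr_add E_eq)
  finally have un: "u ^ n \<le> u * E" .
  have E1: "1 \<le> E" unfolding E_eq using u x by (intro ge_one_powr_ge_zero) auto
  have "(\<Sum>k<n. u ^ k) = (u ^ n - 1) / (u - 1)" using u by (intro geometric_sum) auto
  also have "\<dots> \<le> u * E / (u - 1)" using un u by (intro divide_right_mono) auto
  also have "\<dots> \<le> 2 * E"
  proof -
    have "0 \<le> (u - 2) * E" using u E1 by (intro mult_nonneg_nonneg) auto
    then show ?thesis using u by (simp add: field_simps)
  qed
  finally have head: "(\<Sum>k<n. u ^ k) \<le> 2 * E" .
  have "(R / l) ^ n = (R / l) powr real n" using Rl by (simp add: powr_realpow)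
  also have "\<dots> \<le> (R / l) powr x" using Rl n by (intro powr_mono') auto
  also have "\<dots> = (u / (2 * l / r)) powr x" using assms by (simp add: u_def)
  also have "\<dots> = E / (2 * l / r) powr x"
    unfolding E_eq by (rule powr_divide)
  also have "(2 * l / r) powr x = Q / \<delta>"
    using lnQ lr Q1 assms by (simp add: powr_def x_def)
  finally have "Q * (R / l) ^ n \<le> Q * (E / (Q / \<delta>))"
    using assms by (intro mult_left_mono) auto
  then have tail: "Q * (R / l) ^ n \<le> \<delta> * E" using assms by (simp add: mult.commute)
  have "1 * E \<le> R / r * E" using assms E1 by (intro mult_right_mono) (auto simp: field_simps)
  then have "\<delta> * E \<le> \<delta> * (R / r * E)" using assms by (intro mult_left_mono) auto
  then have "8 * (\<delta> * E) \<le> 8 * (\<delta> * (R / r * E))" by linarith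
  also have "\<dots> = 8 * R / r * E * \<delta>" by simp
  finally have RE: "8 * (\<delta> * E) \<le> 8 * R / r * E * \<delta>" .
  have "2 * \<delta> * (\<Sum>k<n. u ^ k) \<le> 2 * \<delta> * (2 * E)" using head assms by (intro mult_left_mono) auto
  then show ?le using tail RE unfolding E_def[symmetric] u_def[symmetric] by linarith
  have "\<delta> * 1 \<le> \<delta> * E" using E1 assms by (intro mult_left_mono) auto
  moreover have "0 \<le> \<delta> * E" using E1 assms by auto
  ultimately show ?le' using RE unfolding E_def[symmetric] by linarith
qed

theorem theorem5p2:
  fixes v w :: "real ^ 'n \<Rightarrow> complex" and l r R \<delta> :: real
  assumes "integrable lebesgue v"
    and "0 < l" "0 < r" "0 < R" "r \<le> R" "R \<le> l / 2"
    and "Qexp v l < \<infinity>"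
    and "w \<in> borel_measurable (lebesgue_on (ball 0 r))"
    and "Linfty_norm (ball 0 r) (\<lambda>\<xi>. w \<xi> - fourier v \<xi>) \<le> ereal \<delta>"
    and "0 < \<delta>" "\<delta> < enn2real (Qexp v l)"
  defines "Q \<equiv> enn2real (Qexp v l)"
  defines "nstar \<equiv> nat \<lceil>ln (Q / \<delta>) / ln (2 * l / r)\<rceil>"
    and "\<tau> \<equiv> ln (2 * R / r) / ln (2 * l / r)"
  shows "Linfty_norm (ball 0 R) (\<lambda>\<xi>. fourier v \<xi> - extrapolate r R nstar w \<xi>)
           \<le> ereal (8 * R / r * (Q / \<delta>) powr \<tau> * \<delta>)"
proof -
  note v = assms(1) and rR = assms(3,5,6) and \<delta> = assms(10)
  define bound where "bound = 8 * R / r * (Q / \<delta>) powr \<tau> * \<delta>"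
  note bounds = geometric_error_bound[OF rR \<delta> assms(11), folded Q_def, folded nstar_def \<tau>_def, folded bound_def]
  have vl: "integrable lebesgue (\<lambda>x. exp (l * norm x) * cmod (v x))"
    and Q_eq: "Q = (LINT x|lebesgue. exp (l * norm x) * cmod (v x)) / (2 * pi) ^ CARD('n)"
  proof -
    have "(\<lambda>x::real^'n. exp (l * norm x)) \<in> borel_measurable lebesgue"
      by (rule measurable_completion) simp
    then have meas: "(\<lambda>x. exp (l * norm x) * cmod (v x)) \<in> borel_measurable lebesgue"
      using v by (intro borel_measurable_times borel_measurable_norm) auto
    have "(\<integral>\<^sup>+x. ennreal (exp (l * norm x) * cmod (v x)) \<partial>lebesgue) < \<infinity>"
      using assms(7) by (auto simp: Qexp_def ennreal_mult_less_top)
    then show vl: "integrable lebesgue (\<lambda>x. exp (l * norm x) * cmod (v x))"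
      by (intro integrableI_nonneg meas) auto
    show "Q = (LINT x|lebesgue. exp (l * norm x) * cmod (v x)) / (2 * pi) ^ CARD('n)"
      unfolding Q_def Qexp_def by (subst nn_integral_eq_integral[OF vl]) (auto simp: enn2real_mult)
  qed
  have F [measurable]: "fourier v \<in> borel_measurable borel"
    by (intro borel_measurable_continuous_onI continuous_fourier v)
  have ball: "ball 0 r \<inter> space lebesgue \<in> sets (lebesgue :: (real ^ 'n) measure)"
    "ball 0 R \<inter> space lebesgue \<in> sets (lebesgue :: (real ^ 'n) measure)" by auto
  have "AE x in lebesgue. x \<in> ball 0 r \<longrightarrow> cmod (w x - fourier v x) \<le> \<delta>"
  proof -
    have "esssup (lebesgue_on (ball 0 r)) (\<lambda>x. ereal (cmod (w x - fourier v x))) \<le> ereal \<delta>"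
      using assms(9) by (auto simp: Linfty_norm_def split: if_splits)
    with esssup_AE[of "\<lambda>x. ereal (cmod (w x - fourier v x))" "lebesgue_on (ball 0 r)"]
    have "AE x in lebesgue_on (ball 0 r). cmod (w x - fourier v x) \<le> \<delta>"
      by (auto elim!: eventually_mono dest: order_trans)
    then show ?thesis by (simp add: AE_restrict_space_iff[OF ball(1)])
  qed
  then obtain w' N where w' [measurable]: "w' \<in> borel_measurable borel"
    and w'_le: "\<And>x. cmod (w' x - fourier v x) \<le> \<delta>"
    and N: "N \<in> null_sets lborel" "\<And>x. x \<in> ball 0 r \<Longrightarrow> x \<notin> N \<Longrightarrow> w x = w' x"
    by (rule borel_approximant_on_ball[OF assms(8) F _ less_imp_le[OF \<delta>]]) blast
  let ?D = "\<lambda>w \<xi>. fourier v \<xi> - extrapolate r R nstar w \<xi>"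
  have eq: "AE \<xi> in lebesgue. ?D w' \<xi> = ?D w \<xi>"
    unfolding AE_completion_iff
    using AE_null_set_on_rays[OF N(1)] AE_not_in[OF N(1)] AE_lborel_singleton[of 0]
  proof eventually_elim
    fix \<xi> :: "real ^ 'n"
    assume \<xi>: "AE t in lborel. t *\<^sub>R (\<xi> /\<^sub>R norm \<xi>) \<notin> N" "\<xi> \<notin> N" "\<xi> \<noteq> 0"
    have norm_eq: "norm (t *\<^sub>R (\<xi> /\<^sub>R norm \<xi>)) = \<bar>t\<bar>" for t
      unfolding norm_scaleR[of t] using \<xi>(3) by simp
    have "AE t in lborel. t \<in> {-r<..<r} \<longrightarrow> w (t *\<^sub>R (\<xi> /\<^sub>R norm \<xi>)) = w' (t *\<^sub>R (\<xi> /\<^sub>R norm \<xi>))"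
      using \<xi>(1)
      by eventually_elim (intro impI N(2), simp_all only: mem_ball_0 norm_eq, auto)
    then have "cheb_coeff r w k (\<xi> /\<^sub>R norm \<xi>) = cheb_coeff r w' k (\<xi> /\<^sub>R norm \<xi>)" for k
      by (rule cheb_coeff_cong_AE[OF w'])
    then show "?D w' \<xi> = ?D w \<xi>"
      using N(2)[of \<xi>] \<xi>(2) by (simp add: extrapolate_def)
  qed
  have "?D w' \<in> borel_measurable borel"
    by (intro borel_measurable_diff F borel_measurable_extrapolate w')
  then have meas: "?D w \<in> borel_measurable lebesgue"
    by (intro borel_measurable_AE[OF _ eq] measurable_completion) simp
  have err: "cmod (?D w' \<xi>) \<le> bound" if "\<xi> \<in> ball 0 R" for \<xi>
  proof (cases "norm \<xi> < r")
    case True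
    then show ?thesis
      using w'_le[of \<xi>] bounds(2) by (simp add: extrapolate_def norm_minus_commute)
  next
    case False
    then show ?thesis
      using extrapolation_error_le[OF v vl rR w' w'_le, folded Q_eq, of \<xi> nstar] bounds(1) that
      by simp
  qed
  from eq have "AE \<xi> in lebesgue. \<xi> \<in> ball 0 R \<longrightarrow> ereal (cmod (?D w \<xi>)) \<le> ereal bound"
    by eventually_elim (metis err ereal_less_eq(3))
  then have "AE \<xi> in lebesgue_on (ball 0 R). ereal (cmod (?D w \<xi>)) \<le> ereal bound"
    by (simp add: AE_restrict_space_iff[OF ball(2)])
  moreover have m: "?D w \<in> borel_measurable (lebesgue_on (ball 0 R))"
    using meas by (rule measurable_restrict_space1)
  ultimately show ?thesis
    unfolding Linfty_norm_def bound_def[symmetric] by (auto intro!: esssup_I)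
qed

end
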